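(* Let $\Gamma$ be the Veech group of the golden L, generated by $T=\begin{bmatrix}1&\phi\\0&1\end{bmatrix}$ and $R=\begin{bmatrix}0&-1\\1&0\end{bmatrix}$. The $\Gamma$-orbit of the L-necklace $f(1,3,2,4)$ consists of exactly six surfaces, namely $$A=f(1,3,2,4),\ B=f(1,2,2,1),\ C=f(1,1,2,3),\ D=f(1,0,2,0),\ E=f(1,4,2,2),\ F=f(0,1,0,3),$$ on which $T$ acts by $A\to B\to C\to D\to E\to A$, $F\to F$, and $R$ acts by $A\leftrightarrow B$, $D\leftrightarrow F$, $C\to C$, $E\to E$.
   Context: Let $\phi=(1+\sqrt5)/2$. The golden L is the translation surface obtained from the polygon $L=([0,\phi]\times[0,1])\cup([0,1]\times[0,\phi])$ by gluing opposite sides: name the sides $A=\{\phi\}\times[0,1]$, $A'=\{0\}\times[0,1]$, $B=[1,\phi]\times\{1\}$, $B'=[1,\phi]\times\{0\}$, $C=\{1\}\times[1,\phi]$, $C'=\{0\}\times[1,\phi]$, $D=[0,1]\times\{\phi\}$, $D'=[0,1]\times\{0\}$, and glue $A$ to $A'$, $B$ to $B'$, $C$ to $C'$, $D$ to $D'$ by translation. For $(a,b,c,d)\in(\mathbb Z/5\mathbb Z)^4$, $f(a,b,c,d)$ is the translation surface obtained from five copies $L_0,\dots,L_4$ of the polygon $L$ (indices mod 5, with sides $A_j,A_j',\dots,D_j,D_j'$) by gluing by translation $A_j$ to $A'_{j+a}$, $B_j$ to $B'_{j+b}$, $C_j$ to $C'_{j+c}$, $D_j$ to $D'_{j+d}$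 for all $j\in\mathbb Z/5\mathbb Z$. Matrices act on translation surfaces linearly, and translation surfaces are considered up to translation isomorphism (cutting, translating and regluing; in particular relabeling of the five copies). The L-necklace is the image under $P^{-1}$, where $P=\begin{bmatrix}1&\cos(\pi/5)\\0&\sin(\pi/5)\end{bmatrix}$, of the necklace (the ten-pentagon translation surface unfolding the regular pentagon billiard table, with pentagon diagonals of length 1); it is $f(1,3,2,4)$. (The letters $A,\dots,F$ naming the six surfaces are unrelated to the side names.) *)

theory Defs
  imports "HOL-Analysis.Analysis" "HOL-Algebra.Generated_Groups"
begin

section \<open>Translation surfaces\<close>

text \<open>
  A (compact) translation surface is given by a topological space together with its maximal
  translation atlas on the complement of the singularities. A chart is a pair \<open>(U, h)\<close> of an
  open set and a planar coordinate on it; the values of \<open>h\<close> outside \<open>U\<close> are irrelevant. The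
  cone singularities are the points of the space that lie in the domain of no chart.
\<close>

type_synonym plane = "real^2"

record 'a surface =
  surf_top :: "'a topology"
  surf_charts :: "('a set \<times> ('a \<Rightarrow> plane)) set"

text \<open>
  A translation isomorphism is a homeomorphism that identifies the two atlases. As the atlases
  are maximal, this means that it is a translation in the charts.
\<close>

definition translation_iso :: "'a surface \<Rightarrow> 'b surface \<Rightarrow> bool" where
  "translation_iso X Y \<longleftrightarrow>
    (\<exists>F. homeomorphic_map (surf_top X) (surf_top Y) F \<and>
      (\<forall>V k. V \<subseteq> topspace (surf_top Y) \<longrightarrow>
        ((V, k) \<in> surf_charts Y \<longleftrightarrow>
          ({p \<in> topspace (surf_top X). F p \<in> V}, k \<circ> F) \<in> surf_charts X)))"

definition surface_class :: "'a surface \<Rightarrow> 'a surface set" where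
  "surface_class X = {Y. translation_iso X Y}"

text \<open>Linear action of (invertible) matrices, by post-composition with the charts.\<close>

definition matrix_act :: "real^2^2 \<Rightarrow> 'a surface \<Rightarrow> 'a surface" where
  "matrix_act M X =
    \<lparr>surf_top = surf_top X, surf_charts = (\<lambda>(U, h). (U, \<lambda>p. M *v h p)) ` surf_charts X\<rparr>"

text \<open>Orbits consist of surfaces up to translation isomorphism.\<close>

definition surface_orbit :: "(real^2^2) set \<Rightarrow> 'a surface \<Rightarrow> 'a surface set set" where
  "surface_orbit G X = (\<lambda>M. surface_class (matrix_act M X)) ` G"

text \<open>
  An isomorphism from \<open>matrix_act M X\<close> to \<open>X\<close> is exactly an affine automorphism of \<open>X\<close> with
  derivative \<open>M\<close>.
\<close>

definition veech_group :: "'a surface \<Rightarrow> (real^2^2) set" where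
  "veech_group X = {M. det M = 1 \<and> translation_iso (matrix_act M X) X}"

definition SL2 :: "(real^2^2) monoid" where
  "SL2 = \<lparr>carrier = {M. det M = 1}, mult = (**), one = mat 1\<rparr>"


section \<open>Gluing polygons by translations\<close>

text \<open>
  \<open>P i\<close> are the polygons. An element \<open>(i, S, k, t)\<close> of \<open>G\<close> glues the side \<open>S\<close> of \<open>P i\<close> to the
  side \<open>S + t\<close> of \<open>P k\<close>. The points of the glued surface are the equivalence classes of points
  of the disjoint union of the polygons.
\<close>

inductive glue_step ::
  "('i \<times> plane set \<times> 'i \<times> plane) set \<Rightarrow> 'i \<times> plane \<Rightarrow> 'i \<times> plane \<Rightarrow> bool"
  for G where
  "(i, S, k, t) \<in> G \<Longrightarrow> x \<in> S \<Longrightarrow> glue_step G (i, x) (k, x + t)"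

definition glue_class ::
  "('i \<times> plane set \<times> 'i \<times> plane) set \<Rightarrow> 'i \<times> plane \<Rightarrow> ('i \<times> plane) set" where
  "glue_class G p = {q. equivclp (glue_step G) p q}"

definition glued_top ::
  "('i \<Rightarrow> plane set) \<Rightarrow> ('i \<times> plane set \<times> 'i \<times> plane) set \<Rightarrow>
    ('i \<times> plane) set topology" where
  "glued_top P G = topology (\<lambda>U. U \<subseteq> glue_class G ` (SIGMA i:UNIV. P i) \<and>
    openin (sum_topology (\<lambda>i. top_of_set (P i)) UNIV)
      {p \<in> (SIGMA i:UNIV. P i). glue_class G p \<in> U})"

text \<open>
  The atlas consists of all homeomorphisms from open subsets of the quotient to open subsets of
  the plane that are, near every point of every polygon (including the points on its
  sides), translations of the polygon. At a point of cone angle other than \<open>2 * pi\<close> no such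
  homeomorphism exists.
\<close>

definition glued_surface ::
  "('i \<Rightarrow> plane set) \<Rightarrow> ('i \<times> plane set \<times> 'i \<times> plane) set \<Rightarrow>
    ('i \<times> plane) set surface" where
  "glued_surface P G =
    \<lparr>surf_top = glued_top P G,
     surf_charts = {(U, h). openin (glued_top P G) U \<and> open (h ` U) \<and>
       homeomorphic_map (subtopology (glued_top P G) U) (top_of_set (h ` U)) h \<and>
       (\<forall>i. \<forall>x\<in>P i. glue_class G (i, x) \<in> U \<longrightarrow>
         (\<exists>e>0. \<forall>y\<in>P i \<inter> ball x e. glue_class G (i, y) \<in> U \<longrightarrow>
           h (glue_class G (i, y)) = h (glue_class G (i, x)) + (y - x)))}\<rparr>"


section \<open>The golden L and its five-fold covers\<close>

definition phi :: real where
  "phi = (1 + sqrt 5) / 2"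

abbreviation pt :: "real \<Rightarrow> real \<Rightarrow> plane" where
  "pt x y \<equiv> vector [x, y]"

abbreviation rect :: "real \<Rightarrow> real \<Rightarrow> real \<Rightarrow> real \<Rightarrow> plane set" where
  "rect x1 x2 y1 y2 \<equiv> cbox (pt x1 y1) (pt x2 y2)"

definition L_polygon :: "plane set" where
  "L_polygon = rect 0 phi 0 1 \<union> rect 0 1 0 phi"

definition side_A :: "plane set" where "side_A = rect phi phi 0 1"
definition side_B :: "plane set" where "side_B = rect 1 phi 1 1"
definition side_C :: "plane set" where "side_C = rect 1 1 1 phi"
definition side_D :: "plane set" where "side_D = rect 0 1 phi phi"

text \<open>
  Copies of the polygon, indexed by \<open>'i\<close>, with the side \<open>A\<close> of the \<open>j\<close>-th copy
  glued to the opposite side \<open>A'\<close> of the copy \<open>sA j\<close>, and so on. The translation vectors carry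
  \<open>A = {phi} \<times> [0,1]\<close> to \<open>A' = {0} \<times> [0,1]\<close>, \<open>B = [1,phi] \<times> {1}\<close> to \<open>B' = [1,phi] \<times> {0}\<close>,
  \<open>C = {1} \<times> [1,phi]\<close> to \<open>C' = {0} \<times> [1,phi]\<close> and \<open>D = [0,1] \<times> {phi}\<close> to \<open>D' = [0,1] \<times> {0}\<close>.
\<close>

definition L_copies ::
  "('i \<Rightarrow> 'i) \<Rightarrow> ('i \<Rightarrow> 'i) \<Rightarrow> ('i \<Rightarrow> 'i) \<Rightarrow> ('i \<Rightarrow> 'i) \<Rightarrow> ('i \<times> plane) set surface" where
  "L_copies sA sB sC sD = glued_surface (\<lambda>_. L_polygon)
    (range (\<lambda>j. (j, side_A, sA j, pt (- phi) 0)) \<union>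
     range (\<lambda>j. (j, side_B, sB j, pt 0 (- 1))) \<union>
     range (\<lambda>j. (j, side_C, sC j, pt (- 1) 0)) \<union>
     range (\<lambda>j. (j, side_D, sD j, pt 0 (- phi))))"

definition golden_L :: "(unit \<times> plane) set surface" where
  "golden_L = L_copies id id id id"

text \<open>Here \<open>5\<close> is the type of integers modulo 5.\<close>

definition L_cover :: "5 \<Rightarrow> 5 \<Rightarrow> 5 \<Rightarrow> 5 \<Rightarrow> (5 \<times> plane) set surface" where
  "L_cover a b c d = L_copies (\<lambda>j. j + a) (\<lambda>j. j + b) (\<lambda>j. j + c) (\<lambda>j. j + d)"

definition T_mat :: "real^2^2" where
  "T_mat = vector [vector [1, phi], vector [0, 1]]"

definition R_mat :: "real^2^2" where
  "R_mat = vector [vector [0, - 1], vector [1, 0]]"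

end

theory Submission
  imports Defs
begin

text \<open>
  For the positive part, \<open>T\<close> and \<open>R\<close> are realised by cutting and regluing, which turns \<open>f(a, b, c, d)\<close>
  into \<open>f(a, b - a, c, d - a - c)\<close> and \<open>f(- d, c, - b, a)\<close>, while multiplying \<open>(a, b, c, d)\<close> by a
  unit modulo 5 only relabels the copies. A map given on the polygons by affine pieces with a common
  derivative, compatible with the gluings and invertible by a map of the same kind, is an isomorphism
  of translation surfaces.

  For the number of surfaces it is enough to separate \<open>D\<close> from \<open>F\<close>: since \<open>T\<close> permutes \<open>A, ..., E\<close>
  in a 5-cycle and fixes \<open>F\<close>, and \<open>R\<close> exchanges \<open>A\<close> with \<open>B\<close> and \<open>D\<close> with \<open>F\<close>, any coincidence among
  the six classes would force \<open>D = F\<close>. Now \<open>F\<close> has a closed horizontal trajectory of length \<open>phi\<close>,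
  whereas the horizontal cylinders of \<open>D\<close> have circumferences \<open>5 * phi\<close> and \<open>5\<close>, and a trajectory on their
  boundary runs into a vertex, which is singular.
\<close>

section \<open>Translation isomorphisms and the linear action\<close>

text \<open>Since \<open>phi * (phi - 1) = 1\<close>, the two horizontal cylinders of the L, of
  circumference and height phi, 1 and 1, phi - 1, have the same ratio phi of circumference to
  height. Hence the single shear \<open>T_mat\<close> twists both exactly once, and one derivative
  serves the whole polygon.

  The obstacle to separating D from F is that the atlas is maximal: the domain of a chart may spread
  over several copies, so a trajectory cannot simply be read off in the polygons. Instead of
  following it, the proof uses complex functions on the surface that are multiplied by
  \<open>cis (\<kappa> * r)\<close> when a point moves horizontally by \<open>r\<close>. Along a
  closed trajectory of length \<open>l\<close> the accumulated factor
  \<open>cis (\<kappa> * l)\<close> has to fix the value; if the factor is not 1, the function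
  vanishes there. On D three such functions have only the vertices as common zeros.\<close>

lemma matrix_cancel:
  fixes M N :: "'a::comm_semiring_1^'n^'n"
  assumes "M ** N = mat 1"
  shows "M *v (N *v x) = x"
  by (simp add: matrix_vector_mul_assoc assms)

lemma surf_top_matrix_act [simp]: "surf_top (matrix_act M X) = surf_top X"
  by (simp add: matrix_act_def)

lemma matrix_act_one: "matrix_act (mat 1) X = X"
  by (simp add: matrix_act_def)

lemma matrix_act_mult: "matrix_act (M ** N) X = matrix_act M (matrix_act N X)"
  by (simp add: matrix_act_def image_image split_beta matrix_vector_mul_assoc)

lemma charts_matrix_act:
  assumes "M ** N = mat 1" "N ** M = mat 1"
  shows "(U, h) \<in> surf_charts (matrix_act M X) \<longleftrightarrow> (U, \<lambda>p. N *v h p) \<in> surf_charts X"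
proof
  show "(U, \<lambda>p. N *v h p) \<in> surf_charts X" if "(U, h) \<in> surf_charts (matrix_act M X)"
    using that by (auto simp: matrix_act_def matrix_cancel[OF assms(2)])
  show "(U, h) \<in> surf_charts (matrix_act M X)" if "(U, \<lambda>p. N *v h p) \<in> surf_charts X"
    using imageI[OF that, of "\<lambda>(U, h). (U, \<lambda>p. M *v h p)"]
    by (simp add: matrix_act_def matrix_cancel[OF assms(1)])
qed

text \<open>Needed for symmetry of \<open>translation_iso\<close>: carrying a coordinate
  \<open>h\<close> forth and back along mutually inverse homeomorphisms yields
  \<open>h \<circ> G \<circ> F\<close>, which agrees with \<open>h\<close> only on the space, and
  the atlas has to ignore the difference elsewhere.\<close>

definition extensional_charts :: "'a surface \<Rightarrow> bool" where
  "extensional_charts X \<longleftrightarrow>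
    (\<forall>U h h'. (U, h) \<in> surf_charts X \<longrightarrow> (\<forall>p\<in>U. h' p = h p) \<longrightarrow> (U, h') \<in> surf_charts X)"

lemma extensional_charts_cong:
  assumes "extensional_charts X" "\<And>p. p \<in> U \<Longrightarrow> h p = h' p"
  shows "(U, h) \<in> surf_charts X \<longleftrightarrow> (U, h') \<in> surf_charts X"
  using assms unfolding extensional_charts_def by metis

lemma extensional_charts_matrix_act:
  assumes "extensional_charts X" "M ** N = mat 1" "N ** M = mat 1"
  shows "extensional_charts (matrix_act M X)"
  using assms(1) unfolding extensional_charts_def charts_matrix_act[OF assms(2,3)]
  by (metis (no_types, lifting))

lemma translation_iso_refl: "translation_iso X X"
proof -
  have "({p \<in> topspace (surf_top X). p \<in> V}, k) = (V, k)" if "V \<subseteq> topspace (surf_top X)" for V k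
    using that by auto
  then have "\<forall>V k. V \<subseteq> topspace (surf_top X) \<longrightarrow>
      ((V, k) \<in> surf_charts X \<longleftrightarrow> ({p \<in> topspace (surf_top X). id p \<in> V}, k \<circ> id) \<in> surf_charts X)"
    by simp
  moreover have "homeomorphic_map (surf_top X) (surf_top X) id" by simp
  ultimately show ?thesis
    unfolding translation_iso_def by blast
qed

lemma translation_iso_trans:
  assumes "translation_iso X Y" "translation_iso Y Z"
  shows "translation_iso X Z"
proof -
  obtain F where F: "homeomorphic_map (surf_top X) (surf_top Y) F"
    and F': "\<And>V k. V \<subseteq> topspace (surf_top Y) \<Longrightarrow> (V, k) \<in> surf_charts Y \<longleftrightarrow>
          ({p \<in> topspace (surf_top X). F p \<in> V}, k \<circ> F) \<in> surf_charts X"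
    using assms(1) by (auto simp: translation_iso_def)
  obtain G where G: "homeomorphic_map (surf_top Y) (surf_top Z) G"
    and G': "\<And>V k. V \<subseteq> topspace (surf_top Z) \<Longrightarrow> (V, k) \<in> surf_charts Z \<longleftrightarrow>
          ({p \<in> topspace (surf_top Y). G p \<in> V}, k \<circ> G) \<in> surf_charts Y"
    using assms(2) by (auto simp: translation_iso_def)
  have "F p \<in> topspace (surf_top Y)" if "p \<in> topspace (surf_top X)" for p
    using homeomorphic_imp_surjective_map[OF F] that by blast
  then have "{p \<in> topspace (surf_top X). F p \<in> {p \<in> topspace (surf_top Y). G p \<in> V}} =
      {p \<in> topspace (surf_top X). (G \<circ> F) p \<in> V}" for V
    by auto
  then have "(V, k) \<in> surf_charts Z \<longleftrightarrow>
      ({p \<in> topspace (surf_top X). (G \<circ> F) p \<in> V}, k \<circ> (G \<circ> F)) \<in> surf_charts X"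
    if "V \<subseteq> topspace (surf_top Z)" for V k
    using G'[OF that] F'[of "{p \<in> topspace (surf_top Y). G p \<in> V}" "k \<circ> G"]
    by (auto simp: comp_assoc)
  with homeomorphic_map_compose[OF F G] show ?thesis
    by (auto simp: translation_iso_def)
qed

lemma translation_iso_sym:
  assumes "translation_iso X Y" "extensional_charts X"
  shows "translation_iso Y X"
proof -
  obtain F where F: "homeomorphic_map (surf_top X) (surf_top Y) F"
    and F': "\<And>V k. V \<subseteq> topspace (surf_top Y) \<Longrightarrow> (V, k) \<in> surf_charts Y \<longleftrightarrow>
          ({p \<in> topspace (surf_top X). F p \<in> V}, k \<circ> F) \<in> surf_charts X"
    using assms(1) by (auto simp: translation_iso_def)
  obtain G where "homeomorphic_maps (surf_top X) (surf_top Y) F G"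
    using F homeomorphic_map_maps by blast
  then have G: "homeomorphic_map (surf_top Y) (surf_top X) G"
    and GF: "\<And>p. p \<in> topspace (surf_top X) \<Longrightarrow> G (F p) = p"
    by (auto simp: homeomorphic_maps_map)
  have F_top: "F p \<in> topspace (surf_top Y)" if "p \<in> topspace (surf_top X)" for p
    using homeomorphic_imp_surjective_map[OF F] that by blast
  have "(U, h) \<in> surf_charts X \<longleftrightarrow>
      ({q \<in> topspace (surf_top Y). G q \<in> U}, h \<circ> G) \<in> surf_charts Y"
    if "U \<subseteq> topspace (surf_top X)" for U h
  proof -
    have "{p \<in> topspace (surf_top X). F p \<in> {q \<in> topspace (surf_top Y). G q \<in> U}} = U"
      using that GF F_top by auto
    with F'[of "{q \<in> topspace (surf_top Y). G q \<in> U}" "h \<circ> G"]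
    have "({q \<in> topspace (surf_top Y). G q \<in> U}, h \<circ> G) \<in> surf_charts Y \<longleftrightarrow>
        (U, h \<circ> G \<circ> F) \<in> surf_charts X"
      by auto
    also have "\<dots> \<longleftrightarrow> (U, h) \<in> surf_charts X"
      using that GF by (intro extensional_charts_cong[OF assms(2)]) auto
    finally show ?thesis by simp
  qed
  with G show ?thesis by (auto simp: translation_iso_def)
qed

lemma translation_iso_matrix_act:
  assumes "translation_iso X Y" "M ** N = mat 1" "N ** M = mat 1"
  shows "translation_iso (matrix_act M X) (matrix_act M Y)"
proof -
  obtain F where F: "homeomorphic_map (surf_top X) (surf_top Y) F"
    and F': "\<And>V k. V \<subseteq> topspace (surf_top Y) \<Longrightarrow> (V, k) \<in> surf_charts Y \<longleftrightarrow>
          ({p \<in> topspace (surf_top X). F p \<in> V}, k \<circ> F) \<in> surf_charts X"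
    using assms(1) by (auto simp: translation_iso_def)
  have "(V, k) \<in> surf_charts (matrix_act M Y) \<longleftrightarrow>
      ({p \<in> topspace (surf_top X). F p \<in> V}, k \<circ> F) \<in> surf_charts (matrix_act M X)"
    if "V \<subseteq> topspace (surf_top Y)" for V k
    using F'[OF that, of "\<lambda>p. N *v k p"]
    by (simp add: charts_matrix_act[OF assms(2,3)] o_def)
  with F show ?thesis by (auto simp: translation_iso_def)
qed

lemma surface_class_eq_iff:
  fixes X :: "'a surface"
  assumes "extensional_charts X"
  shows "surface_class X = surface_class Y \<longleftrightarrow> translation_iso X Y"
proof
  show "translation_iso X Y" if "surface_class X = surface_class Y"
    using translation_iso_refl[of Y] that by (auto simp: surface_class_def)
  assume XY: "translation_iso X Y"
  have "translation_iso X Z \<longleftrightarrow> translation_iso Y Z" for Z :: "'a surface"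
    using translation_iso_trans[OF XY] translation_iso_trans[OF translation_iso_sym[OF XY assms]]
    by metis
  then show "surface_class X = surface_class Y" by (simp add: surface_class_def)
qed


section \<open>The topology and the atlas of a glued surface\<close>

lemma glue_class_self: "p \<in> glue_class G p"
  by (simp add: glue_class_def)

lemma glue_class_eq_iff: "glue_class G p = glue_class G q \<longleftrightarrow> equivclp (glue_step G) p q"
  unfolding glue_class_def
  by (auto intro: equivclp_sym equivclp_trans set_eqI)

lemma glue_class_step:
  assumes "(i, S, k, t) \<in> G" "x \<in> S"
  shows "glue_class G (i, x) = glue_class G (k, x + t)"
  unfolding glue_class_eq_iff using assms by (blast intro: glue_step.intros)

text \<open>These functions descend to the quotient. They serve both to define maps between glued
  surfaces and, through \<open>glue_invariant_class\<close>, to prove that two points are not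
  identified.\<close>

definition glue_invariant ::
  "('i \<times> plane set \<times> 'i \<times> plane) set \<Rightarrow> ('i \<times> plane \<Rightarrow> 'b) \<Rightarrow> bool" where
  "glue_invariant G g \<longleftrightarrow> (\<forall>(i, S, k, t)\<in>G. \<forall>x\<in>S. g (i, x) = g (k, x + t))"

lemma glue_invariant_class:
  assumes "glue_invariant G g" "glue_class G p = glue_class G q"
  shows "g p = g q"
proof -
  have step: "g r = g s" if "glue_step G r s" for r s
    using that assms(1) by cases (force simp: glue_invariant_def)
  have "equivclp (glue_step G) p q"
    using assms(2) by (simp add: glue_class_eq_iff)
  then show ?thesis
    by (induction rule: equivclp_induct) (auto simp: step)
qed

definition glue_lift :: "('i \<times> plane \<Rightarrow> 'b) \<Rightarrow> ('i \<times> plane) set \<Rightarrow> 'b" where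
  "glue_lift g c = g (SOME p. p \<in> c)"

lemma glue_lift_class:
  assumes "glue_invariant G g"
  shows "glue_lift g (glue_class G p) = g p"
proof -
  have "(SOME q. q \<in> glue_class G p) \<in> glue_class G p"
    using glue_class_self by (rule someI)
  then have "glue_class G p = glue_class G (SOME q. q \<in> glue_class G p)"
    unfolding glue_class_eq_iff by (simp add: glue_class_def)
  from glue_invariant_class[OF assms this] show ?thesis by (simp add: glue_lift_def)
qed

lemma openin_glued_top:
  "openin (glued_top P G) U \<longleftrightarrow> U \<subseteq> glue_class G ` (SIGMA i:UNIV. P i) \<and>
    (\<forall>i. openin (top_of_set (P i)) {x \<in> P i. glue_class G (i, x) \<in> U})"
proof -
  let ?E = "SIGMA i:UNIV. P i"
  let ?T = "sum_topology (\<lambda>i. top_of_set (P i)) UNIV"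
  let ?Q = "\<lambda>U. U \<subseteq> glue_class G ` ?E \<and> openin ?T {p \<in> ?E. glue_class G p \<in> U}"
  have "istopology ?Q"
    unfolding istopology_def
  proof (intro conjI allI impI)
    fix S T assume S: "?Q S" and T: "?Q T"
    show "S \<inter> T \<subseteq> glue_class G ` ?E" using S by blast
    have "{p \<in> ?E. glue_class G p \<in> S \<inter> T} =
        {p \<in> ?E. glue_class G p \<in> S} \<inter> {p \<in> ?E. glue_class G p \<in> T}" by blast
    then show "openin ?T {p \<in> ?E. glue_class G p \<in> S \<inter> T}"
      using S T by (metis (no_types, lifting) openin_Int)
  next
    fix \<K> assume K: "\<forall>K\<in>\<K>. ?Q K"
    show "\<Union>\<K> \<subseteq> glue_class G ` ?E" using K by blast
    have "{p \<in> ?E. glue_class G p \<in> \<Union>\<K>} = (\<Union>K\<in>\<K>. {p \<in> ?E. glue_class G p \<in> K})" by blast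
    then show "openin ?T {p \<in> ?E. glue_class G p \<in> \<Union>\<K>}"
      using K by (metis (no_types, lifting) openin_Union imageE)
  qed
  then have "openin (glued_top P G) U \<longleftrightarrow> ?Q U"
    by (simp add: glued_top_def topology_inverse')
  also have "\<dots> \<longleftrightarrow> U \<subseteq> glue_class G ` ?E \<and>
    (\<forall>i. openin (top_of_set (P i)) {x \<in> P i. glue_class G (i, x) \<in> U})"
    by (auto simp: openin_sum_topology)
  finally show ?thesis .
qed

lemma topspace_glued_top: "topspace (glued_top P G) = glue_class G ` (SIGMA i:UNIV. P i)"
proof
  show "topspace (glued_top P G) \<subseteq> glue_class G ` (SIGMA i:UNIV. P i)"
    using openin_topspace[of "glued_top P G"] unfolding openin_glued_top by blast
  have "{x \<in> P i. glue_class G (i, x) \<in> glue_class G ` (SIGMA i:UNIV. P i)} = P i" for i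
    by auto
  then have "openin (glued_top P G) (glue_class G ` (SIGMA i:UNIV. P i))"
    unfolding openin_glued_top by simp
  then show "glue_class G ` (SIGMA i:UNIV. P i) \<subseteq> topspace (glued_top P G)"
    by (rule openin_subset)
qed

lemma surf_top_glued [simp]: "surf_top (glued_surface P G) = glued_top P G"
  by (simp add: glued_surface_def)

lemma charts_glued:
  "(U, h) \<in> surf_charts (glued_surface P G) \<longleftrightarrow>
    openin (glued_top P G) U \<and> open (h ` U) \<and>
    homeomorphic_map (subtopology (glued_top P G) U) (top_of_set (h ` U)) h \<and>
    (\<forall>i. \<forall>x\<in>P i. glue_class G (i, x) \<in> U \<longrightarrow>
      (\<exists>e>0. \<forall>y\<in>P i \<inter> ball x e. glue_class G (i, y) \<in> U \<longrightarrow>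
        h (glue_class G (i, y)) = h (glue_class G (i, x)) + (y - x)))"
  by (simp add: glued_surface_def)

lemma extensional_charts_glued: "extensional_charts (glued_surface P G)"
  unfolding extensional_charts_def
proof (intro allI impI)
  fix U h h'
  assume h: "(U, h) \<in> surf_charts (glued_surface P G)" and eq: "\<forall>p\<in>U. h' p = h p"
  have "h' ` U = h ` U" using eq by auto
  moreover have "homeomorphic_map (subtopology (glued_top P G) U) (top_of_set (h ` U)) h'"
    by (rule homeomorphic_map_eq[of _ _ h]) (use h eq in \<open>auto simp: charts_glued\<close>)
  ultimately show "(U, h') \<in> surf_charts (glued_surface P G)"
    using h eq unfolding charts_glued by simp
qed


section \<open>Locally affine maps into a surface\<close>

text \<open>
  At the singularities, which lie in no chart, only continuity is required.
\<close>

definition local_affine ::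
  "real^2^2 \<Rightarrow> plane set \<Rightarrow> (plane \<Rightarrow> 'a) \<Rightarrow> 'a surface \<Rightarrow> bool" where
  "local_affine M S f Y \<longleftrightarrow> continuous_map (top_of_set S) (surf_top Y) f \<and>
    (\<forall>V k. (V, k) \<in> surf_charts Y \<longrightarrow> (\<forall>x\<in>S. f x \<in> V \<longrightarrow>
      (\<exists>e>0. \<forall>y\<in>S \<inter> ball x e. f y \<in> V \<longrightarrow> k (f y) = k (f x) + M *v (y - x))))"

lemma local_affine_continuous: "local_affine M S f Y \<Longrightarrow> continuous_map (top_of_set S) (surf_top Y) f"
  by (simp add: local_affine_def)

lemma local_affineD:
  assumes "local_affine M S f Y" "(V, k) \<in> surf_charts Y" "x \<in> S" "f x \<in> V"
  obtains e where "e > 0"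
    "\<And>y. y \<in> S \<Longrightarrow> dist x y < e \<Longrightarrow> f y \<in> V \<Longrightarrow> k (f y) = k (f x) + M *v (y - x)"
  using assms unfolding local_affine_def by (metis Int_iff mem_ball)

lemma local_affine_cong:
  assumes "\<And>x. x \<in> S \<Longrightarrow> f x = g x"
  shows "local_affine M S f Y \<longleftrightarrow> local_affine M S g Y"
proof -
  have "continuous_map (top_of_set S) (surf_top Y) f \<longleftrightarrow> continuous_map (top_of_set S) (surf_top Y) g"
    using assms by (intro iffI; elim continuous_map_eq) auto
  then show ?thesis
    using assms unfolding local_affine_def by (metis (no_types, lifting) Int_iff)
qed

lemma local_affine_glue_class:
  "local_affine (mat 1) (P i) (\<lambda>x. glue_class G (i, x)) (glued_surface P G)"
proof -
  have "continuous_map (top_of_set (P i)) (glued_top P G) (\<lambda>x. glue_class G (i, x))"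
    unfolding continuous_map_def by (auto simp: openin_glued_top topspace_glued_top)
  then show ?thesis
    by (auto simp: local_affine_def charts_glued)
qed

lemma local_affine_compose:
  assumes f: "local_affine N S f Y" and sub: "\<And>x. x \<in> C \<Longrightarrow> M *v x + v \<in> S"
  shows "local_affine (N ** M) C (\<lambda>x. f (M *v x + v)) Y"
proof -
  have lin: "bounded_linear ((*v) M)" by simp
  have "continuous_on C (\<lambda>x. M *v x + v)"
    by (intro continuous_intros linear_continuous_on lin)
  with sub have "continuous_map (top_of_set C) (top_of_set S) (\<lambda>x. M *v x + v)"
    by auto
  from continuous_map_compose[OF this local_affine_continuous[OF f]]
  have "continuous_map (top_of_set C) (surf_top Y) (\<lambda>x. f (M *v x + v))"
    by (simp add: o_def)
  moreover have "\<exists>e>0. \<forall>y\<in>C \<inter> ball x e. f (M *v y + v) \<in> V \<longrightarrow>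
      k (f (M *v y + v)) = k (f (M *v x + v)) + (N ** M) *v (y - x)"
    if V: "(V, k) \<in> surf_charts Y" and x: "x \<in> C" "f (M *v x + v) \<in> V" for V k x
  proof -
    obtain e where e: "e > 0" "\<And>y. y \<in> S \<Longrightarrow> dist (M *v x + v) y < e \<Longrightarrow> f y \<in> V \<Longrightarrow>
        k (f y) = k (f (M *v x + v)) + N *v (y - (M *v x + v))"
      using local_affineD[OF f V sub[OF x(1)] x(2)] by blast
    have "isCont (\<lambda>x. M *v x) x"
      by (intro linear_continuous_at lin)
    then obtain d where d: "d > 0" "\<And>y. dist y x < d \<Longrightarrow> dist (M *v y) (M *v x) < e"
      using \<open>e > 0\<close> unfolding continuous_at_eps_delta by metis
    have "k (f (M *v y + v)) = k (f (M *v x + v)) + (N ** M) *v (y - x)"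
      if "y \<in> C \<inter> ball x d" "f (M *v y + v) \<in> V" for y
    proof -
      have "dist (M *v x + v) (M *v y + v) < e"
        using d(2)[of y] that by (simp add: dist_commute)
      from e(2)[OF sub this that(2)] that(1) show ?thesis
        by (simp add: matrix_vector_mul_assoc[symmetric] matrix_vector_mult_diff_distrib)
    qed
    with d(1) show ?thesis by blast
  qed
  ultimately show ?thesis by (simp add: local_affine_def)
qed

text \<open>Closedness is used twice: continuity is the pasting lemma, and a point outside one of
  the pieces has a ball missing that piece, so its affine condition is vacuous there.\<close>

lemma local_affine_Un:
  assumes f: "local_affine M S f Y" "local_affine M C f Y" and cl: "closed S" "closed C"
  shows "local_affine M (S \<union> C) f Y"
proof -
  have "continuous_map (top_of_set (S \<union> C)) (surf_top Y) f"
    unfolding continuous_map_closedin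
  proof (intro conjI allI impI)
    fix K assume K: "closedin (surf_top Y) K"
    have "closed {x \<in> S. f x \<in> K}" "closed {x \<in> C. f x \<in> K}"
      using f[THEN local_affine_continuous] K cl unfolding continuous_map_closedin
      by (auto intro: closedin_closed_trans)
    moreover have "{x \<in> S \<union> C. f x \<in> K} = {x \<in> S. f x \<in> K} \<union> {x \<in> C. f x \<in> K}" by auto
    ultimately show "closedin (top_of_set (S \<union> C)) {x \<in> topspace (top_of_set (S \<union> C)). f x \<in> K}"
      by (auto intro!: closed_subset)
  qed (use f[THEN local_affine_continuous] in \<open>auto simp: continuous_map_def\<close>)
  moreover have "\<exists>e>0. \<forall>y\<in>(S \<union> C) \<inter> ball x e. f y \<in> V \<longrightarrow> k (f y) = k (f x) + M *v (y - x)"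
    if V: "(V, k) \<in> surf_charts Y" and x: "x \<in> S \<union> C" "f x \<in> V" for V k x
  proof -
    have *: "\<exists>e>0. \<forall>y\<in>B \<inter> ball x e. f y \<in> V \<longrightarrow> k (f y) = k (f x) + M *v (y - x)"
      if B: "local_affine M B f Y" "closed B" for B
    proof (cases "x \<in> B")
      case True
      with B(1) V x(2) show ?thesis by (simp add: local_affine_def)
    next
      case False
      then have "x \<in> - B" "open (- B)" using B(2) by auto
      then obtain e where "e > 0" "ball x e \<subseteq> - B" using openE by blast
      then show ?thesis by blast
    qed
    obtain d e where "d > 0" "e > 0"
      "\<forall>y\<in>S \<inter> ball x d. f y \<in> V \<longrightarrow> k (f y) = k (f x) + M *v (y - x)"
      "\<forall>y\<in>C \<inter> ball x e. f y \<in> V \<longrightarrow> k (f y) = k (f x) + M *v (y - x)"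
      using *[OF f(1) cl(1)] *[OF f(2) cl(2)] by blast
    then show ?thesis by (intro exI[of _ "min d e"]) auto
  qed
  ultimately show ?thesis by (simp add: local_affine_def)
qed

section \<open>Passing to the quotient: a criterion for isomorphism of glued surfaces\<close>

lemma continuous_map_from_glued:
  assumes "\<And>i. continuous_map (top_of_set (P i)) Z (\<lambda>x. F (glue_class G (i, x)))"
  shows "continuous_map (glued_top P G) Z F"
  unfolding continuous_map_def
proof (intro conjI allI impI)
  show "F \<in> topspace (glued_top P G) \<rightarrow> topspace Z"
    using assms by (auto simp: topspace_glued_top continuous_map_def)
  fix V assume V: "openin Z V"
  have "{x \<in> P i. glue_class G (i, x) \<in> {c \<in> topspace (glued_top P G). F c \<in> V}} =
      {x \<in> topspace (top_of_set (P i)). F (glue_class G (i, x)) \<in> V}" for i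
    by (auto simp: topspace_glued_top)
  moreover have "openin (top_of_set (P i)) {x \<in> topspace (top_of_set (P i)). F (glue_class G (i, x)) \<in> V}" for i
    using assms V unfolding continuous_map_def by blast
  ultimately show "openin (glued_top P G) {c \<in> topspace (glued_top P G). F c \<in> V}"
    unfolding openin_glued_top by (auto simp: topspace_glued_top)
qed

text \<open>In polygon coordinates \<open>k \<circ> F\<close> has derivative \<open>M\<close>, and
  applying \<open>N\<close> makes it a translation. The chart properties of \<open>V\<close> and
  \<open>k\<close> are hypotheses because \<open>Y\<close> is an arbitrary record, whose atlas
  guarantees nothing about its members.\<close>

lemma chart_pullback:
  assumes F: "homeomorphic_map (glued_top P G) (surf_top Y) F"
    and aff: "\<And>i. local_affine M (P i) (\<lambda>x. F (glue_class G (i, x))) Y"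
    and inv: "M ** N = mat 1" "N ** M = mat 1"
    and V: "(V, k) \<in> surf_charts Y" "openin (surf_top Y) V" "open (k ` V)"
      "homeomorphic_map (subtopology (surf_top Y) V) (top_of_set (k ` V)) k"
  shows "({c \<in> topspace (glued_top P G). F c \<in> V}, \<lambda>c. N *v k (F c)) \<in>
    surf_charts (glued_surface P G)"
proof -
  define U where "U = {c \<in> topspace (glued_top P G). F c \<in> V}"
  have surj: "F ` topspace (glued_top P G) = topspace (surf_top Y)"
    by (rule homeomorphic_imp_surjective_map[OF F])
  have "V \<subseteq> F ` topspace (glued_top P G)"
    using openin_subset[OF V(2)] by (simp add: surj)
  then have FU: "F ` U = V"
    unfolding U_def by auto
  have "openin (glued_top P G) U"
    unfolding U_def using homeomorphic_imp_continuous_map[OF F] V(2)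
    by (rule openin_continuous_map_preimage)
  moreover have img: "(\<lambda>c. N *v k (F c)) ` U = (*v) N ` k ` V"
    using FU by (metis image_image)
  have NkV: "(*v) N ` k ` V = (*v) M -` k ` V"
    by (force simp: matrix_cancel[OF inv(1)] image_iff
        intro: matrix_cancel[OF inv(2), symmetric])
  then have "open ((\<lambda>c. N *v k (F c)) ` U)"
    unfolding img NkV by (intro open_vimage V(3) linear_continuous_on) simp
  moreover have "homeomorphic_map (subtopology (glued_top P G) U)
      (top_of_set ((\<lambda>c. N *v k (F c)) ` U)) (\<lambda>c. N *v k (F c))"
  proof -
    have 1: "homeomorphic_map (subtopology (glued_top P G) U) (subtopology (surf_top Y) V) F"
      using FU surj by (intro homeomorphic_map_subtopologies[OF F]) (auto simp: U_def)
    have "homeomorphic_maps (top_of_set (k ` V)) (top_of_set ((*v) N ` k ` V)) ((*v) N) ((*v) M)"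
      using linear_continuous_on[OF matrix_vector_mul_bounded_linear]
      by (auto simp: homeomorphic_maps_def matrix_cancel[OF inv(1)] matrix_cancel[OF inv(2)])
    then have "homeomorphic_map (top_of_set (k ` V)) (top_of_set ((*v) N ` k ` V)) ((*v) N)"
      by (simp add: homeomorphic_maps_map)
    from homeomorphic_map_compose[OF homeomorphic_map_compose[OF 1 V(4)] this]
    show ?thesis unfolding img by (simp add: o_def)
  qed
  moreover have "\<exists>e>0. \<forall>y\<in>P i \<inter> ball x e. glue_class G (i, y) \<in> U \<longrightarrow>
      N *v k (F (glue_class G (i, y))) = N *v k (F (glue_class G (i, x))) + (y - x)"
    if x: "x \<in> P i" "glue_class G (i, x) \<in> U" for i x
  proof -
    have "F (glue_class G (i, x)) \<in> V" using x(2) by (simp add: U_def)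
    from local_affineD[OF aff V(1) x(1) this] obtain e where e: "e > 0"
      "\<And>y. y \<in> P i \<Longrightarrow> dist x y < e \<Longrightarrow> F (glue_class G (i, y)) \<in> V \<Longrightarrow>
        k (F (glue_class G (i, y))) = k (F (glue_class G (i, x))) + M *v (y - x)" by metis
    then show ?thesis
      by (intro exI[of _ e])
        (auto simp: U_def matrix_vector_right_distrib matrix_cancel[OF inv(2)])
  qed
  ultimately show ?thesis
    unfolding U_def[symmetric] charts_glued by blast
qed

text \<open>Each implication between the atlases is \<open>chart_pullback\<close>, once for
  \<open>F\<close> and once for \<open>F'\<close>. In the second case the chart obtained agrees with
  \<open>k\<close> only on \<open>V\<close>, and extensionality closes the gap.\<close>

proposition glued_translation_iso:
  assumes F: "\<And>i. local_affine M (P i) (\<lambda>x. F (glue_class G (i, x))) (glued_surface P' G')"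
    and F': "\<And>i. local_affine N (P' i) (\<lambda>x. F' (glue_class G' (i, x))) (glued_surface P G)"
    and inv: "M ** N = mat 1" "N ** M = mat 1"
    and F'F: "\<And>i x. x \<in> P i \<Longrightarrow> F' (F (glue_class G (i, x))) = glue_class G (i, x)"
    and FF': "\<And>i x. x \<in> P' i \<Longrightarrow> F (F' (glue_class G' (i, x))) = glue_class G' (i, x)"
  shows "translation_iso (matrix_act M (glued_surface P G)) (glued_surface P' G')"
proof -
  have "homeomorphic_maps (glued_top P G) (glued_top P' G') F F'"
    unfolding homeomorphic_maps_def
    using F[THEN local_affine_continuous] F'[THEN local_affine_continuous] F'F FF'
    by (auto simp: topspace_glued_top intro!: continuous_map_from_glued)
  then have hF: "homeomorphic_map (glued_top P G) (glued_top P' G') F"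
    and hF': "homeomorphic_map (glued_top P' G') (glued_top P G) F'"
    by (auto simp: homeomorphic_maps_map)
  have "(V, k) \<in> surf_charts (glued_surface P' G') \<longleftrightarrow>
      ({c \<in> topspace (glued_top P G). F c \<in> V}, \<lambda>c. N *v k (F c)) \<in> surf_charts (glued_surface P G)"
    (is "_ \<longleftrightarrow> (?U, ?h) \<in> _")
    if V: "V \<subseteq> topspace (glued_top P' G')" for V k
  proof
    assume "(V, k) \<in> surf_charts (glued_surface P' G')"
    then show "(?U, ?h) \<in> surf_charts (glued_surface P G)"
      using chart_pullback[of P G "glued_surface P' G'" F M N V k] hF F inv by (simp add: charts_glued)
  next
    assume "(?U, ?h) \<in> surf_charts (glued_surface P G)"
    then have "({c \<in> topspace (glued_top P' G'). F' c \<in> ?U}, \<lambda>c. M *v ?h (F' c)) \<in>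
        surf_charts (glued_surface P' G')"
      using chart_pullback[of P' G' "glued_surface P G" F' N M ?U ?h] hF' F' inv
      by (simp add: charts_glued)
    moreover have top: "F' c \<in> topspace (glued_top P G) \<and> F (F' c) = c"
      if "c \<in> topspace (glued_top P' G')" for c
    proof
      show "F' c \<in> topspace (glued_top P G)"
        using imageI[OF that, of F'] by (simp add: homeomorphic_imp_surjective_map[OF hF'])
      show "F (F' c) = c"
        using that FF' by (auto simp: topspace_glued_top)
    qed
    have "{c \<in> topspace (glued_top P' G'). F' c \<in> ?U} = V"
      using V top by auto
    ultimately have "(V, \<lambda>c. M *v ?h (F' c)) \<in> surf_charts (glued_surface P' G')"
      by simp
    moreover have "M *v ?h (F' c) = k c" if "c \<in> V" for c
      using that V top by (auto simp: matrix_cancel[OF inv(1)])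
    ultimately show "(V, k) \<in> surf_charts (glued_surface P' G')"
      by (subst extensional_charts_cong[OF extensional_charts_glued,
          where h = k and h' = "\<lambda>c. M *v ?h (F' c)"]) auto
  qed
  then show ?thesis
    using hF unfolding translation_iso_def
    by (intro exI[of _ F]) (simp add: charts_matrix_act[OF inv] o_def)
qed

section \<open>Cyclic covers of the golden L\<close>

lemma phi_gt_1: "phi > 1" and phi_less_2: "phi < 2"
  using real_less_rsqrt[of 1 5] real_less_lsqrt[of 3 5] by (auto simp: phi_def)

lemma phi_square: "phi * phi = phi + 1"
  by (simp add: phi_def field_simps)

lemma pt_eta: "pt (v $ 1) (v $ 2) = v"
  by (simp add: vec_eq_iff forall_2)

lemma mem_rect: "v \<in> rect x1 x2 y1 y2 \<longleftrightarrow> x1 \<le> v $ 1 \<and> v $ 1 \<le> x2 \<and> y1 \<le> v $ 2 \<and> v $ 2 \<le> y2"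
  by (auto simp: mem_box_cart forall_2)

lemma pt_plus: "pt x y + pt x' y' = pt (x + x') (y + y')"
  and pt_minus: "pt x y - pt x' y' = pt (x - x') (y - y')"
  by (simp_all add: vec_eq_iff forall_2)

lemma mem_L_polygon:
  "v \<in> L_polygon \<longleftrightarrow> 0 \<le> v $ 1 \<and> 0 \<le> v $ 2 \<and> (v $ 1 \<le> phi \<and> v $ 2 \<le> 1 \<or> v $ 1 \<le> 1 \<and> v $ 2 \<le> phi)"
  by (auto simp: L_polygon_def mem_rect)

lemma side_simps:
  "v \<in> side_A \<longleftrightarrow> v $ 1 = phi \<and> 0 \<le> v $ 2 \<and> v $ 2 \<le> 1"
  "v \<in> side_B \<longleftrightarrow> v $ 2 = 1 \<and> 1 \<le> v $ 1 \<and> v $ 1 \<le> phi"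
  "v \<in> side_C \<longleftrightarrow> v $ 1 = 1 \<and> 1 \<le> v $ 2 \<and> v $ 2 \<le> phi"
  "v \<in> side_D \<longleftrightarrow> v $ 2 = phi \<and> 0 \<le> v $ 1 \<and> v $ 1 \<le> 1"
  by (auto simp: side_A_def side_B_def side_C_def side_D_def mem_rect)

text \<open>The labels form an arbitrary abelian group, as cutting and regluing uses no more. The
  modulus 5 enters with the concrete tuples and with \<open>character5\<close>.\<close>

definition L_gluing ::
  "'i::ab_group_add \<Rightarrow> 'i \<Rightarrow> 'i \<Rightarrow> 'i \<Rightarrow> ('i \<times> plane set \<times> 'i \<times> plane) set" where
  "L_gluing a b c d =
    range (\<lambda>j. (j, side_A, j + a, pt (- phi) 0)) \<union>
    range (\<lambda>j. (j, side_B, j + b, pt 0 (- 1))) \<union>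
    range (\<lambda>j. (j, side_C, j + c, pt (- 1) 0)) \<union>
    range (\<lambda>j. (j, side_D, j + d, pt 0 (- phi)))"

abbreviation L_glued :: "'i::ab_group_add \<Rightarrow> 'i \<Rightarrow> 'i \<Rightarrow> 'i \<Rightarrow> ('i \<times> plane) set surface" where
  "L_glued a b c d \<equiv> glued_surface (\<lambda>_. L_polygon) (L_gluing a b c d)"

lemma L_cover_eq: "L_cover a b c d = L_glued a b c d"
  by (simp add: L_cover_def L_copies_def L_gluing_def)

abbreviation cls ::
  "'i::ab_group_add \<Rightarrow> 'i \<Rightarrow> 'i \<Rightarrow> 'i \<Rightarrow> 'i \<Rightarrow> real \<Rightarrow> real \<Rightarrow> ('i \<times> plane) set" where
  "cls a b c d j x y \<equiv> glue_class (L_gluing a b c d) (j, pt x y)"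

lemma cls_A: "0 \<le> y \<Longrightarrow> y \<le> 1 \<Longrightarrow> cls a b c d j phi y = cls a b c d (j + a) 0 y"
  using glue_class_step[of j side_A "j + a" "pt (- phi) 0" "L_gluing a b c d" "pt phi y"]
  by (simp add: L_gluing_def side_simps pt_plus)

lemma cls_B: "1 \<le> x \<Longrightarrow> x \<le> phi \<Longrightarrow> cls a b c d j x 1 = cls a b c d (j + b) x 0"
  using glue_class_step[of j side_B "j + b" "pt 0 (- 1)" "L_gluing a b c d" "pt x 1"]
  by (simp add: L_gluing_def side_simps pt_plus)

lemma cls_C: "1 \<le> y \<Longrightarrow> y \<le> phi \<Longrightarrow> cls a b c d j 1 y = cls a b c d (j + c) 0 y"
  using glue_class_step[of j side_C "j + c" "pt (- 1) 0" "L_gluing a b c d" "pt 1 y"]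
  by (simp add: L_gluing_def side_simps pt_plus)

lemma cls_D: "0 \<le> x \<Longrightarrow> x \<le> 1 \<Longrightarrow> cls a b c d j x phi = cls a b c d (j + d) x 0"
  using glue_class_step[of j side_D "j + d" "pt 0 (- phi)" "L_gluing a b c d" "pt x phi"]
  by (simp add: L_gluing_def side_simps pt_plus)

lemma glue_invariant_L:
  assumes "\<And>j y. 0 \<le> y \<Longrightarrow> y \<le> 1 \<Longrightarrow> g (j, pt phi y) = g (j + a, pt 0 y)"
    and "\<And>j x. 1 \<le> x \<Longrightarrow> x \<le> phi \<Longrightarrow> g (j, pt x 1) = g (j + b, pt x 0)"
    and "\<And>j y. 1 \<le> y \<Longrightarrow> y \<le> phi \<Longrightarrow> g (j, pt 1 y) = g (j + c, pt 0 y)"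
    and "\<And>j x. 0 \<le> x \<Longrightarrow> x \<le> 1 \<Longrightarrow> g (j, pt x phi) = g (j + d, pt x 0)"
  shows "glue_invariant (L_gluing a b c d) g"
proof -
  have "g (j, v) = g (k, v + t)" if "(j, S, k, t) \<in> L_gluing a b c d" "v \<in> S" for j S k t v
    using that assms(1)[of "v $ 2" j] assms(2)[of "v $ 1" j] assms(3)[of "v $ 2" j]
      assms(4)[of "v $ 1" j] pt_eta[of v]
    by (auto simp: L_gluing_def side_simps)
      (metis add.right_neutral add.right_inverse pt_plus)+
  then show ?thesis by (auto simp: glue_invariant_def)
qed

lemma local_affine_cls:
  assumes "\<And>v. v \<in> S \<Longrightarrow> v + w \<in> L_polygon"
  shows "local_affine (mat 1) S (\<lambda>v. glue_class (L_gluing a b c d) (j, v + w)) (L_glued a b c d)"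
  using local_affine_compose[OF local_affine_glue_class, of S "mat 1" w "\<lambda>_. L_polygon" j] assms
  by simp

text \<open>
  The two horizontal cylinders, developed rightwards across the sides \<open>A\<close> and \<open>C\<close> from the
  \<open>j\<close>-th copy.
\<close>

definition bottom ::
  "'i::ab_group_add \<Rightarrow> 'i \<Rightarrow> 'i \<Rightarrow> 'i \<Rightarrow> 'i \<Rightarrow> real \<Rightarrow> real \<Rightarrow> ('i \<times> plane) set" where
  "bottom a b c d j x y = (if x \<le> phi then cls a b c d j x y else cls a b c d (j + a) (x - phi) y)"

definition top_cyl ::
  "'i::ab_group_add \<Rightarrow> 'i \<Rightarrow> 'i \<Rightarrow> 'i \<Rightarrow> 'i \<Rightarrow> real \<Rightarrow> real \<Rightarrow> ('i \<times> plane) set" where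
  "top_cyl a b c d j x y = (if x \<le> 1 then cls a b c d j x y else cls a b c d (j + c) (x - 1) y)"

text \<open>Only at the seam \<open>x = 0\<close> does the definition select the other branch; there
  the gluing of side A gives the same point.\<close>

lemma bottom_shift:
  "0 \<le> x \<Longrightarrow> 0 \<le> y \<Longrightarrow> y \<le> 1 \<Longrightarrow> bottom a b c d j (x + phi) y = cls a b c d (j + a) x y"
  by (cases "x = 0") (auto simp: bottom_def cls_A)

lemma top_cyl_shift:
  "0 \<le> x \<Longrightarrow> 1 \<le> y \<Longrightarrow> y \<le> phi \<Longrightarrow> top_cyl a b c d j (x + 1) y = cls a b c d (j + c) x y"
  by (cases "x = 0") (auto simp: top_cyl_def cls_C)

text \<open>Two circumferences are enough, since a single twist displaces a point by at most
  one.\<close>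

lemma local_affine_bottom:
  "local_affine (mat 1) (rect 0 (2 * phi) 0 1) (\<lambda>v. bottom a b c d j (v $ 1) (v $ 2)) (L_glued a b c d)"
proof -
  have "local_affine (mat 1) (rect 0 phi 0 1) (\<lambda>v. glue_class (L_gluing a b c d) (j, v + 0)) (L_glued a b c d)"
    by (rule local_affine_cls) (auto simp: mem_rect mem_L_polygon)
  then have 1: "local_affine (mat 1) (rect 0 phi 0 1) (\<lambda>v. bottom a b c d j (v $ 1) (v $ 2)) (L_glued a b c d)"
    by (rule local_affine_cong[THEN iffD1, rotated]) (auto simp: mem_rect bottom_def pt_eta)
  have "local_affine (mat 1) (rect phi (2 * phi) 0 1)
      (\<lambda>v. glue_class (L_gluing a b c d) (j + a, v + pt (- phi) 0)) (L_glued a b c d)"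
    by (rule local_affine_cls) (auto simp: mem_rect mem_L_polygon)
  then have 2: "local_affine (mat 1) (rect phi (2 * phi) 0 1) (\<lambda>v. bottom a b c d j (v $ 1) (v $ 2)) (L_glued a b c d)"
  proof (rule local_affine_cong[THEN iffD1, rotated])
    fix v assume "v \<in> rect phi (2 * phi) 0 1"
    then have "bottom a b c d j (v $ 1 - phi + phi) (v $ 2) = cls a b c d (j + a) (v $ 1 - phi) (v $ 2)"
      by (intro bottom_shift) (auto simp: mem_rect)
    moreover have "v + pt (- phi) 0 = pt (v $ 1 - phi) (v $ 2)"
      by (simp add: vec_eq_iff forall_2)
    ultimately show "glue_class (L_gluing a b c d) (j + a, v + pt (- phi) 0) = bottom a b c d j (v $ 1) (v $ 2)"
      by simp
  qed
  have "rect 0 (2 * phi) 0 1 = rect 0 phi 0 1 \<union> rect phi (2 * phi) 0 1"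
    using phi_gt_1 by (auto simp: mem_rect)
  with local_affine_Un[OF 1 2 closed_cbox closed_cbox] show ?thesis by simp
qed

lemma local_affine_top_cyl:
  "local_affine (mat 1) (rect 0 2 1 phi) (\<lambda>v. top_cyl a b c d j (v $ 1) (v $ 2)) (L_glued a b c d)"
proof -
  have "local_affine (mat 1) (rect 0 1 1 phi) (\<lambda>v. glue_class (L_gluing a b c d) (j, v + 0)) (L_glued a b c d)"
    by (rule local_affine_cls) (auto simp: mem_rect mem_L_polygon)
  then have 1: "local_affine (mat 1) (rect 0 1 1 phi) (\<lambda>v. top_cyl a b c d j (v $ 1) (v $ 2)) (L_glued a b c d)"
    by (rule local_affine_cong[THEN iffD1, rotated]) (auto simp: mem_rect top_cyl_def pt_eta)
  have "local_affine (mat 1) (rect 1 2 1 phi)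
      (\<lambda>v. glue_class (L_gluing a b c d) (j + c, v + pt (- 1) 0)) (L_glued a b c d)"
    by (rule local_affine_cls) (auto simp: mem_rect mem_L_polygon)
  then have 2: "local_affine (mat 1) (rect 1 2 1 phi) (\<lambda>v. top_cyl a b c d j (v $ 1) (v $ 2)) (L_glued a b c d)"
  proof (rule local_affine_cong[THEN iffD1, rotated])
    fix v assume "v \<in> rect 1 2 1 phi"
    then have "top_cyl a b c d j (v $ 1 - 1 + 1) (v $ 2) = cls a b c d (j + c) (v $ 1 - 1) (v $ 2)"
      by (intro top_cyl_shift) (auto simp: mem_rect)
    moreover have "v + pt (- 1) 0 = pt (v $ 1 - 1) (v $ 2)"
      by (simp add: vec_eq_iff forall_2)
    ultimately show "glue_class (L_gluing a b c d) (j + c, v + pt (- 1) 0) = top_cyl a b c d j (v $ 1) (v $ 2)"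
      by simp
  qed
  have "rect 0 2 1 phi = rect 0 1 1 phi \<union> rect 1 2 1 phi"
    by (auto simp: mem_rect)
  with local_affine_Un[OF 1 2 closed_cbox closed_cbox] show ?thesis by simp
qed

lemma local_affine_L:
  assumes "local_affine M (rect 0 phi 0 1) f Y" "local_affine M (rect 0 1 1 phi) g Y"
    and "\<And>v. v \<in> L_polygon \<Longrightarrow> v $ 2 \<le> 1 \<Longrightarrow> h v = f v"
    and "\<And>v. v \<in> L_polygon \<Longrightarrow> v $ 2 > 1 \<Longrightarrow> h v = g v"
    and "\<And>x. 0 \<le> x \<Longrightarrow> x \<le> 1 \<Longrightarrow> f (pt x 1) = g (pt x 1)"
  shows "local_affine M L_polygon h Y"
proof -
  have 1: "local_affine M (rect 0 phi 0 1) h Y"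
    using assms(1) by (rule local_affine_cong[THEN iffD1, rotated])
      (auto simp: assms(3) mem_rect mem_L_polygon)
  have eq: "g v = h v" if v: "v \<in> rect 0 1 1 phi" for v
  proof (cases "v $ 2 = 1")
    case True
    then show ?thesis
      using v assms(3)[of v] assms(5)[of "v $ 1"] phi_gt_1 pt_eta[of v]
      by (auto simp: mem_rect mem_L_polygon)
  next
    case False
    with v show ?thesis by (intro assms(4)[symmetric]) (auto simp: mem_rect mem_L_polygon)
  qed
  have 2: "local_affine M (rect 0 1 1 phi) h Y"
    using local_affine_cong[of "rect 0 1 1 phi" g h, OF eq] assms(2) by blast
  have "L_polygon = rect 0 phi 0 1 \<union> rect 0 1 1 phi"
    using phi_gt_1 by (auto simp: mem_rect mem_L_polygon)
  with local_affine_Un[OF 1 2 closed_cbox closed_cbox] show ?thesis by simp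
qed

text \<open>The cut is at abscissa 1 instead of height 1, because this is where the two branches of
  \<open>unturn\<close> meet.\<close>

lemma local_affine_L_right:
  assumes "local_affine M (rect 0 1 0 phi) f Y" "local_affine M (rect 1 phi 0 1) g Y"
    and "\<And>v. v \<in> L_polygon \<Longrightarrow> v $ 1 \<le> 1 \<Longrightarrow> h v = f v"
    and "\<And>v. v \<in> L_polygon \<Longrightarrow> v $ 1 > 1 \<Longrightarrow> h v = g v"
    and "\<And>y. 0 \<le> y \<Longrightarrow> y \<le> 1 \<Longrightarrow> f (pt 1 y) = g (pt 1 y)"
  shows "local_affine M L_polygon h Y"
proof -
  have 1: "local_affine M (rect 0 1 0 phi) h Y"
    using assms(1) by (rule local_affine_cong[THEN iffD1, rotated])
      (auto simp: assms(3) mem_rect mem_L_polygon)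
  have eq: "g v = h v" if v: "v \<in> rect 1 phi 0 1" for v
  proof (cases "v $ 1 = 1")
    case True
    then show ?thesis
      using v assms(3)[of v] assms(5)[of "v $ 2"] phi_gt_1 pt_eta[of v]
      by (auto simp: mem_rect mem_L_polygon)
  next
    case False
    with v show ?thesis by (intro assms(4)[symmetric]) (auto simp: mem_rect mem_L_polygon)
  qed
  have 2: "local_affine M (rect 1 phi 0 1) h Y"
    using local_affine_cong[of "rect 1 phi 0 1" g h, OF eq] assms(2) by blast
  have "L_polygon = rect 0 1 0 phi \<union> rect 1 phi 0 1"
    using phi_gt_1 by (auto simp: mem_rect mem_L_polygon)
  with local_affine_Un[OF 1 2 closed_cbox closed_cbox] show ?thesis by simp
qed


section \<open>The action of the generators\<close>

definition T_inv :: "real^2^2" where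
  "T_inv = vector [vector [1, - phi], vector [0, 1]]"

definition R_inv :: "real^2^2" where
  "R_inv = vector [vector [0, 1], vector [- 1, 0]]"

lemma mat2_mult:
  "(vector [vector [p, q], vector [r, s]] :: real^2^2) *v v = pt (p * v $ 1 + q * v $ 2) (r * v $ 1 + s * v $ 2)"
  by (simp add: vec_eq_iff forall_2 matrix_vector_mult_def sum_2)

lemma T_inverse: "T_mat ** T_inv = mat 1" "T_inv ** T_mat = mat 1"
  by (simp_all add: T_mat_def T_inv_def vec_eq_iff forall_2 matrix_matrix_mult_def sum_2 mat_def)

lemma R_inverse: "R_mat ** R_inv = mat 1" "R_inv ** R_mat = mat 1"
  by (simp_all add: R_mat_def R_inv_def vec_eq_iff forall_2 matrix_matrix_mult_def sum_2 mat_def)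

text \<open>
  \<open>T\<close> twists each horizontal cylinder once around. This displaces the top of the bottom cylinder by
  the \<open>a\<close> copies of one passage through \<open>A\<close>, and the top of the other by a further \<open>c\<close>.
  Hence the gluing \<open>(a, b - a, c, d - a - c)\<close> of the image.
\<close>

definition shear ::
  "'i::ab_group_add \<Rightarrow> 'i \<Rightarrow> 'i \<Rightarrow> 'i \<Rightarrow> 'i \<times> plane \<Rightarrow> ('i \<times> plane) set" where
  "shear a b c d = (\<lambda>(j, v).
    if v $ 2 \<le> 1 then bottom a (b - a) c (d - a - c) j (v $ 1 + phi * v $ 2) (v $ 2)
    else top_cyl a (b - a) c (d - a - c) (j + a) (v $ 1 + phi * (v $ 2 - 1)) (v $ 2))"

lemma shear_pt:
  "shear a b c d (j, pt x y) =
    (if y \<le> 1 then bottom a (b - a) c (d - a - c) j (x + phi * y) y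
     else top_cyl a (b - a) c (d - a - c) (j + a) (x + phi * (y - 1)) y)"
  by (simp add: shear_def)

text \<open>The inverse twist moves points to the left, but the cylinders are developed only
  rightwards. So the development begins in the preceding copy of the cylinder, with one
  circumference (\<open>phi\<close> or \<open>1\<close>) added to the abscissa. The further
  \<open>- a\<close> in the top branch undoes the displacement of the top cylinder.\<close>

definition unshear ::
  "'i::ab_group_add \<Rightarrow> 'i \<Rightarrow> 'i \<Rightarrow> 'i \<Rightarrow> 'i \<times> plane \<Rightarrow> ('i \<times> plane) set" where
  "unshear a b c d = (\<lambda>(j, v).
    if v $ 2 \<le> 1 then bottom a b c d (j - a) (v $ 1 - phi * v $ 2 + phi) (v $ 2)
    else top_cyl a b c d (j - a - c) (v $ 1 - phi * (v $ 2 - 1) + 1) (v $ 2))"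

lemma unshear_pt:
  "unshear a b c d (j, pt x y) =
    (if y \<le> 1 then bottom a b c d (j - a) (x - phi * y + phi) y
     else top_cyl a b c d (j - a - c) (x - phi * (y - 1) + 1) y)"
  by (simp add: unshear_def)

text \<open>At height 1 the bottom branch has moved by exactly one circumference into copy
  \<open>j + a\<close>, which is where the top branch starts with no displacement. So the top
  formula is valid on the closed rectangle.\<close>

lemma shear_top:
  assumes "0 \<le> x" "x \<le> 1" "1 \<le> y" "y \<le> phi"
  shows "shear a b c d (j, pt x y) = top_cyl a (b - a) c (d - a - c) (j + a) (x + phi * (y - 1)) y"
  using assms bottom_shift[of x 1 a "b - a" c "d - a - c" j] by (simp add: shear_def top_cyl_def)

lemma unshear_top:
  assumes "0 \<le> x" "x \<le> 1" "1 \<le> y" "y \<le> phi"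
  shows "unshear a b c d (j, pt x y) = top_cyl a b c d (j - a - c) (x - phi * (y - 1) + 1) y"
  using assms top_cyl_shift[of x 1 a b c d "j - a - c"] phi_gt_1
  by (simp add: unshear_def bottom_def)

lemma glue_invariant_shear: "glue_invariant (L_gluing a b c d) (shear a b c d)"
proof (rule glue_invariant_L)
  fix j :: 'a and y :: real
  assume y: "0 \<le> y" "y \<le> 1"
  have "phi * y \<le> phi" using y phi_gt_1 by simp
  then show "shear a b c d (j, pt phi y) = shear a b c d (j + a, pt 0 y)"
    using y phi_gt_1 bottom_shift[of "phi * y" y a "b - a" c "d - a - c" j]
    by (simp add: shear_def add.commute bottom_def)
next
  fix j :: 'a and x :: real
  assume x: "1 \<le> x" "x \<le> phi"
  \<comment> \<open>At height 1 the image lies in copy \<open>j + a\<close>; a shift of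
    \<open>b - a\<close> through B is what leads from there to \<open>j + b\<close>.\<close>
  then show "shear a b c d (j, pt x 1) = shear a b c d (j + b, pt x 0)"
    using bottom_shift[of x 1 a "b - a" c "d - a - c" j]
    by (simp add: shear_def bottom_def cls_B)
next
  fix j :: 'a and y :: real
  assume y: "1 \<le> y" "y \<le> phi"
  have "phi * (y - 1) \<le> 1"
    using mult_left_mono[OF y(2), of phi] phi_gt_1 phi_square by (simp add: algebra_simps)
  then show "shear a b c d (j, pt 1 y) = shear a b c d (j + c, pt 0 y)"
    using y phi_gt_1 top_cyl_shift[of "phi * (y - 1)" y a "b - a" c "d - a - c" "j + a"]
    by (simp add: shear_top top_cyl_def[of _ _ _ _ _ "phi * (y - 1)"] ac_simps)
next
  fix j :: 'a and x :: real
  assume x: "0 \<le> x" "x \<le> 1"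
  \<comment> \<open>At height \<open>phi\<close> the top cylinder has turned by its full
    circumference 1, so the image lies in copy \<open>j + a + c\<close>; this accounts for
    \<open>d - a - c\<close>.\<close>
  have "phi * (phi - 1) = 1" using phi_square by (simp add: algebra_simps)
  then show "shear a b c d (j, pt x phi) = shear a b c d (j + d, pt x 0)"
    using x phi_gt_1 top_cyl_shift[of x phi a "b - a" c "d - a - c" "j + a"]
    by (simp add: shear_top) (simp add: shear_def bottom_def cls_D algebra_simps)
qed

lemma glue_invariant_unshear: "glue_invariant (L_gluing a (b - a) c (d - a - c)) (unshear a b c d)"
proof (rule glue_invariant_L)
  fix j :: 'a and y :: real
  assume y: "0 \<le> y" "y \<le> 1"
  have "phi * y \<le> phi" using y phi_gt_1 by simp
  then show "unshear a b c d (j, pt phi y) = unshear a b c d (j + a, pt 0 y)"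
    using y phi_gt_1 bottom_shift[of "phi - phi * y" y a b c d "j - a"]
    by (simp add: unshear_def bottom_def)
next
  fix j :: 'a and x :: real
  assume x: "1 \<le> x" "x \<le> phi"
  then show "unshear a b c d (j, pt x 1) = unshear a b c d (j + (b - a), pt x 0)"
    using bottom_shift[of x 0 a b c d "j + (b - a) - a"]
    by (simp add: unshear_def bottom_def cls_B algebra_simps)
next
  fix j :: 'a and y :: real
  assume y: "1 \<le> y" "y \<le> phi"
  have "phi * (y - 1) \<le> 1"
    using mult_left_mono[OF y(2), of phi] phi_gt_1 phi_square by (simp add: algebra_simps)
  then show "unshear a b c d (j, pt 1 y) = unshear a b c d (j + c, pt 0 y)"
    using y phi_gt_1 top_cyl_shift[of "1 - phi * (y - 1)" y a b c d "j - a - c"]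
    by (simp add: unshear_top top_cyl_def[of _ _ _ _ _ "phi + 1 - phi * y"] algebra_simps)
next
  fix j :: 'a and x :: real
  assume x: "0 \<le> x" "x \<le> 1"
  have "phi * (phi - 1) = 1" using phi_square by (simp add: algebra_simps)
  then show "unshear a b c d (j, pt x phi) = unshear a b c d (j + (d - a - c), pt x 0)"
    using x phi_gt_1 bottom_shift[of x 0 a b c d "j + (d - a - c) - a"]
    by (simp add: unshear_top top_cyl_def) (simp add: unshear_def cls_D algebra_simps)
qed

lemma local_affine_shear:
  "local_affine T_mat L_polygon (\<lambda>v. shear a b c d (j, v)) (L_glued a (b - a) c (d - a - c))"
proof (rule local_affine_L)
  have "v $ 1 + phi * v $ 2 \<le> 2 * phi \<and> 0 \<le> v $ 1 + phi * v $ 2" if "v \<in> rect 0 phi 0 1" for v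
  proof -
    have "0 \<le> v $ 1" "v $ 1 \<le> phi" "0 \<le> v $ 2" "v $ 2 \<le> 1"
      using that by (auto simp: mem_rect)
    moreover from this have "phi * v $ 2 \<le> phi" "0 \<le> phi * v $ 2"
      using phi_gt_1 by simp_all
    ultimately show ?thesis by (intro conjI; linarith)
  qed
  then have "local_affine (mat 1 ** T_mat) (rect 0 phi 0 1)
      (\<lambda>v. bottom a (b - a) c (d - a - c) j ((T_mat *v v + 0) $ 1) ((T_mat *v v + 0) $ 2))
      (L_glued a (b - a) c (d - a - c))"
    by (intro local_affine_compose[OF local_affine_bottom]) (auto simp: T_mat_def mat2_mult mem_rect)
  then show "local_affine T_mat (rect 0 phi 0 1)
      (\<lambda>v. bottom a (b - a) c (d - a - c) j (v $ 1 + phi * v $ 2) (v $ 2)) (L_glued a (b - a) c (d - a - c))"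
    by (simp add: T_mat_def mat2_mult)
  have "v $ 1 + phi * v $ 2 - phi \<le> 2 \<and> 0 \<le> v $ 1 + phi * v $ 2 - phi" if "v \<in> rect 0 1 1 phi" for v
  proof -
    have "0 \<le> v $ 1" "v $ 1 \<le> 1" "1 \<le> v $ 2" "v $ 2 \<le> phi"
      using that by (auto simp: mem_rect)
    moreover from this have "phi * v $ 2 \<le> phi + 1" "phi \<le> phi * v $ 2"
      using phi_gt_1 mult_left_mono[of "v $ 2" phi phi] by (simp_all add: phi_square)
    ultimately show ?thesis by (intro conjI; linarith)
  qed
  \<comment> \<open>The copy \<open>j + a\<close> already accounts for one passage along the bottom
    cylinder, so its circumference is subtracted from the linear shear.\<close>
  then have "local_affine (mat 1 ** T_mat) (rect 0 1 1 phi)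
      (\<lambda>v. top_cyl a (b - a) c (d - a - c) (j + a)
        ((T_mat *v v + pt (- phi) 0) $ 1) ((T_mat *v v + pt (- phi) 0) $ 2))
      (L_glued a (b - a) c (d - a - c))"
    by (intro local_affine_compose[OF local_affine_top_cyl]) (auto simp: T_mat_def mat2_mult mem_rect)
  then show "local_affine T_mat (rect 0 1 1 phi)
      (\<lambda>v. top_cyl a (b - a) c (d - a - c) (j + a) (v $ 1 + phi * (v $ 2 - 1)) (v $ 2))
      (L_glued a (b - a) c (d - a - c))"
    by (simp add: T_mat_def mat2_mult algebra_simps)
  show "bottom a (b - a) c (d - a - c) j (pt x 1 $ 1 + phi * pt x 1 $ 2) (pt x 1 $ 2) =
      top_cyl a (b - a) c (d - a - c) (j + a) (pt x 1 $ 1 + phi * (pt x 1 $ 2 - 1)) (pt x 1 $ 2)"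
    if "0 \<le> x" "x \<le> 1" for x
    using that shear_top[of x 1 a b c d j] phi_gt_1 by (simp add: shear_def)
qed (auto simp: shear_def)

lemma local_affine_unshear:
  "local_affine T_inv L_polygon (\<lambda>v. unshear a b c d (j, v)) (L_glued a b c d)"
proof (rule local_affine_L)
  have "v $ 1 - phi * v $ 2 + phi \<le> 2 * phi \<and> 0 \<le> v $ 1 - phi * v $ 2 + phi"
    if "v \<in> rect 0 phi 0 1" for v
  proof -
    have "0 \<le> v $ 1" "v $ 1 \<le> phi" "0 \<le> v $ 2" "v $ 2 \<le> 1"
      using that by (auto simp: mem_rect)
    moreover from this have "phi * v $ 2 \<le> phi" "0 \<le> phi * v $ 2"
      using phi_gt_1 by simp_all
    ultimately show ?thesis by (intro conjI; linarith)
  qed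
  then have "local_affine (mat 1 ** T_inv) (rect 0 phi 0 1)
      (\<lambda>v. bottom a b c d (j - a) ((T_inv *v v + pt phi 0) $ 1) ((T_inv *v v + pt phi 0) $ 2))
      (L_glued a b c d)"
    by (intro local_affine_compose[OF local_affine_bottom]) (auto simp: T_inv_def mat2_mult mem_rect)
  then show "local_affine T_inv (rect 0 phi 0 1)
      (\<lambda>v. bottom a b c d (j - a) (v $ 1 - phi * v $ 2 + phi) (v $ 2)) (L_glued a b c d)"
    by (simp add: T_inv_def mat2_mult)
  have "v $ 1 - phi * v $ 2 + (phi + 1) \<le> 2 \<and> 0 \<le> v $ 1 - phi * v $ 2 + (phi + 1)"
    if "v \<in> rect 0 1 1 phi" for v
  proof -
    have "0 \<le> v $ 1" "v $ 1 \<le> 1" "1 \<le> v $ 2" "v $ 2 \<le> phi"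
      using that by (auto simp: mem_rect)
    moreover from this have "phi * v $ 2 \<le> phi + 1" "phi \<le> phi * v $ 2"
      using phi_gt_1 mult_left_mono[of "v $ 2" phi phi] by (simp_all add: phi_square)
    ultimately show ?thesis by (intro conjI; linarith)
  qed
  then have "local_affine (mat 1 ** T_inv) (rect 0 1 1 phi)
      (\<lambda>v. top_cyl a b c d (j - a - c)
        ((T_inv *v v + pt (phi + 1) 0) $ 1) ((T_inv *v v + pt (phi + 1) 0) $ 2))
      (L_glued a b c d)"
    by (intro local_affine_compose[OF local_affine_top_cyl]) (auto simp: T_inv_def mat2_mult mem_rect)
  then show "local_affine T_inv (rect 0 1 1 phi)
      (\<lambda>v. top_cyl a b c d (j - a - c) (v $ 1 - phi * (v $ 2 - 1) + 1) (v $ 2))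
      (L_glued a b c d)"
    by (simp add: T_inv_def mat2_mult algebra_simps)
  show "bottom a b c d (j - a) (pt x 1 $ 1 - phi * pt x 1 $ 2 + phi) (pt x 1 $ 2) =
      top_cyl a b c d (j - a - c) (pt x 1 $ 1 - phi * (pt x 1 $ 2 - 1) + 1) (pt x 1 $ 2)"
    if "0 \<le> x" "x \<le> 1" for x
    using that unshear_top[of x 1 a b c d j] phi_gt_1 by (simp add: unshear_def)
qed (auto simp: unshear_def)

text \<open>The cases are whether the shear has carried the point across A (or C). If not,
  \<open>unshear\<close> finds it one circumference beyond \<open>x\<close>, developed from the
  preceding copy; if so, it finds it at \<open>x\<close> itself.\<close>

lemma unshear_shear:
  assumes "v \<in> L_polygon"
  shows "glue_lift (unshear a b c d) (shear a b c d (j, v)) = glue_class (L_gluing a b c d) (j, v)"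
proof -
  define x y where "x = v $ 1" "y = v $ 2"
  have v: "v = pt x y" by (simp add: x_y_def pt_eta)
  have xy: "0 \<le> x" "0 \<le> y" "y \<le> 1 \<Longrightarrow> x \<le> phi" "\<not> y \<le> 1 \<Longrightarrow> x \<le> 1 \<and> y \<le> phi"
    using assms phi_gt_1 by (auto simp: mem_L_polygon x_y_def)
  note lift = glue_lift_class[OF glue_invariant_unshear]
  show ?thesis
  proof (cases "y \<le> 1")
    case True
    then have "bottom a b c d (j - a) (x + phi) y = cls a b c d j x y" "bottom a b c d j x y = cls a b c d j x y"
      using xy bottom_shift[of x y a b c d "j - a"] by (simp_all add: bottom_def[of _ _ _ _ _ x])
    with True show ?thesis
      by (cases "x + phi * y \<le> phi")
        (simp_all add: v lift shear_pt unshear_pt bottom_def[of _ _ _ _ _ "x + phi * y"])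
  next
    case False
    then have "top_cyl a b c d (j - c) (x + 1) y = cls a b c d j x y" "top_cyl a b c d j x y = cls a b c d j x y"
      using xy top_cyl_shift[of x y a b c d "j - c"] by (simp_all add: top_cyl_def[of _ _ _ _ _ x])
    with False show ?thesis
      by (cases "x + phi * (y - 1) \<le> 1")
        (simp_all add: v lift shear_pt unshear_pt top_cyl_def[of _ _ _ _ _ "x + phi * (y - 1)"])
  qed
qed

lemma shear_unshear:
  assumes "v \<in> L_polygon"
  shows "glue_lift (shear a b c d) (unshear a b c d (j, v)) =
    glue_class (L_gluing a (b - a) c (d - a - c)) (j, v)"
proof -
  define x y where "x = v $ 1" "y = v $ 2"
  have v: "v = pt x y" by (simp add: x_y_def pt_eta)
  have xy: "0 \<le> x" "0 \<le> y" "y \<le> 1 \<Longrightarrow> x \<le> phi" "\<not> y \<le> 1 \<Longrightarrow> x \<le> 1 \<and> y \<le> phi"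
    using assms phi_gt_1 by (auto simp: mem_L_polygon x_y_def)
  note lift = glue_lift_class[OF glue_invariant_shear]
  let ?b = "bottom a (b - a) c (d - a - c)" and ?t = "top_cyl a (b - a) c (d - a - c)"
  let ?q = "cls a (b - a) c (d - a - c) j x y"
  show ?thesis
  proof (cases "y \<le> 1")
    case True
    then have "?b (j - a) (x + phi) y = ?q" "?b j x y = ?q"
      using xy bottom_shift[of x y a "b - a" c "d - a - c" "j - a"] by (simp_all add: bottom_def[of _ _ _ _ _ x])
    with True show ?thesis
      by (cases "x - phi * y + phi \<le> phi")
        (simp_all add: v lift shear_pt unshear_pt bottom_def[of _ _ _ _ _ "x - phi * y + phi"])
  next
    case False
    then have "?t (j - c) (x + 1) y = ?q" "?t j x y = ?q"
      using xy top_cyl_shift[of x y a "b - a" c "d - a - c" "j - c"] by (simp_all add: top_cyl_def[of _ _ _ _ _ x])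
    with False show ?thesis
      by (cases "x - phi * (y - 1) + 1 \<le> 1")
        (simp_all add: v lift shear_pt unshear_pt top_cyl_def[of _ _ _ _ _ "x - phi * (y - 1) + 1"])
  qed
qed

proposition T_act: "translation_iso (matrix_act T_mat (L_glued a b c d)) (L_glued a (b - a) c (d - a - c))"
proof (rule glued_translation_iso[OF _ _ T_inverse, where F = "glue_lift (shear a b c d)"
      and F' = "glue_lift (unshear a b c d)"])
qed (simp_all add: glue_lift_class[OF glue_invariant_shear] glue_lift_class[OF glue_invariant_unshear]
    local_affine_shear local_affine_unshear shear_unshear unshear_shear)

text \<open>
  After a quarter turn the upper arm of the \<open>j\<close>-th copy lies to the left of its square. Moving
  it through \<open>D\<close> makes it the right arm of the copy \<open>j + d\<close>.
\<close>

definition turn ::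
  "'i::ab_group_add \<Rightarrow> 'i \<Rightarrow> 'i \<Rightarrow> 'i \<Rightarrow> 'i \<times> plane \<Rightarrow> ('i \<times> plane) set" where
  "turn a b c d = (\<lambda>(j, v).
    if v $ 2 \<le> 1 then cls (- d) c (- b) a j (1 - v $ 2) (v $ 1)
    else cls (- d) c (- b) a (j + d) (1 + phi - v $ 2) (v $ 1))"

definition unturn ::
  "'i::ab_group_add \<Rightarrow> 'i \<Rightarrow> 'i \<Rightarrow> 'i \<Rightarrow> 'i \<times> plane \<Rightarrow> ('i \<times> plane) set" where
  "unturn a b c d = (\<lambda>(j, v).
    if v $ 1 \<le> 1 then cls a b c d j (v $ 2) (1 - v $ 1)
    else cls a b c d (j - d) (v $ 2) (1 + phi - v $ 1))"

lemma turn_pt: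
  "turn a b c d (j, pt x y) =
    (if y \<le> 1 then cls (- d) c (- b) a j (1 - y) x else cls (- d) c (- b) a (j + d) (1 + phi - y) x)"
  by (simp add: turn_def)

lemma unturn_pt:
  "unturn a b c d (j, pt x y) =
    (if x \<le> 1 then cls a b c d j y (1 - x) else cls a b c d (j - d) y (1 + phi - x))"
  by (simp add: unturn_def)

text \<open>On the cut at height 1 the moved arm has abscissa \<open>phi\<close>, that is, it ends
  on side A of copy \<open>j + d\<close>, and the new shift \<open>- d\<close> leads back to copy
  \<open>j\<close>.\<close>

lemma turn_top:
  assumes "0 \<le> x" "x \<le> 1" "1 \<le> y" "y \<le> phi"
  shows "turn a b c d (j, pt x y) = cls (- d) c (- b) a (j + d) (1 + phi - y) x"
  using assms cls_A[of x "- d" c "- b" a "j + d"] by (auto simp: turn_def)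

lemma unturn_right:
  assumes "1 \<le> x" "x \<le> phi" "0 \<le> y" "y \<le> 1"
  shows "unturn a b c d (j, pt x y) = cls a b c d (j - d) y (1 + phi - x)"
  using assms cls_D[of y a b c d "j - d"] by (auto simp: unturn_def)

text \<open>The turn carries the gluing A to D, C to B, and B to C traversed backwards, whence
  \<open>- b\<close>. The arm has been moved through D, so D becomes interior and both sides agree
  outright; the cut at height 1 becomes the new A, traversed backwards, whence
  \<open>- d\<close>.\<close>

lemma glue_invariant_turn: "glue_invariant (L_gluing a b c d) (turn a b c d)"
proof (rule glue_invariant_L)
  show "turn a b c d (j, pt phi y) = turn a b c d (j + a, pt 0 y)" if "0 \<le> y" "y \<le> 1" for j y
    using that cls_D[of "1 - y" "- d" c "- b" a j] by (simp add: turn_def)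
  show "turn a b c d (j, pt x 1) = turn a b c d (j + b, pt x 0)" if "1 \<le> x" "x \<le> phi" for j x
    using that cls_C[of x "- d" c "- b" a "j + b"] by (simp add: turn_def)
  show "turn a b c d (j, pt 1 y) = turn a b c d (j + c, pt 0 y)" if "1 \<le> y" "y \<le> phi" for j y
    using that cls_B[of "1 + phi - y" "- d" c "- b" a "j + d"] by (simp add: turn_top ac_simps)
  show "turn a b c d (j, pt x phi) = turn a b c d (j + d, pt x 0)" if "0 \<le> x" "x \<le> 1" for j x
    using that phi_gt_1 by (simp add: turn_def)
qed

lemma glue_invariant_unturn: "glue_invariant (L_gluing (- d) c (- b) a) (unturn a b c d)"
proof (rule glue_invariant_L)
  show "unturn a b c d (j, pt phi y) = unturn a b c d (j + - d, pt 0 y)" if "0 \<le> y" "y \<le> 1" for j y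
    using that phi_gt_1 by (simp add: unturn_def)
  show "unturn a b c d (j, pt x 1) = unturn a b c d (j + c, pt x 0)" if "1 \<le> x" "x \<le> phi" for j x
    using that cls_C[of "1 + phi - x" a b c d "j - d"] by (simp add: unturn_right algebra_simps)
  show "unturn a b c d (j, pt 1 y) = unturn a b c d (j + - b, pt 0 y)" if "1 \<le> y" "y \<le> phi" for j y
    using that cls_B[of y a b c d "j - b"] by (simp add: unturn_def)
  show "unturn a b c d (j, pt x phi) = unturn a b c d (j + a, pt x 0)" if "0 \<le> x" "x \<le> 1" for j x
    using that cls_A[of "1 - x" a b c d j] by (simp add: unturn_def)
qed

lemma local_affine_turn:
  "local_affine R_mat L_polygon (\<lambda>v. turn a b c d (j, v)) (L_glued (- d) c (- b) a)"
proof (rule local_affine_L)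
  have "local_affine (mat 1 ** R_mat) (rect 0 phi 0 1)
      (\<lambda>v. glue_class (L_gluing (- d) c (- b) a) (j, R_mat *v v + pt 1 0)) (L_glued (- d) c (- b) a)"
    by (intro local_affine_compose[OF local_affine_glue_class])
      (auto simp: R_mat_def mat2_mult mem_rect mem_L_polygon)
  then show "local_affine R_mat (rect 0 phi 0 1) (\<lambda>v. cls (- d) c (- b) a j (1 - v $ 2) (v $ 1))
      (L_glued (- d) c (- b) a)"
    by (simp add: R_mat_def mat2_mult pt_plus algebra_simps)
  have "local_affine (mat 1 ** R_mat) (rect 0 1 1 phi)
      (\<lambda>v. glue_class (L_gluing (- d) c (- b) a) (j + d, R_mat *v v + pt (1 + phi) 0))
      (L_glued (- d) c (- b) a)"
    by (intro local_affine_compose[OF local_affine_glue_class])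
      (auto simp: R_mat_def mat2_mult mem_rect mem_L_polygon)
  then show "local_affine R_mat (rect 0 1 1 phi)
      (\<lambda>v. cls (- d) c (- b) a (j + d) (1 + phi - v $ 2) (v $ 1)) (L_glued (- d) c (- b) a)"
    by (simp add: R_mat_def mat2_mult pt_plus algebra_simps)
  show "cls (- d) c (- b) a j (1 - pt x 1 $ 2) (pt x 1 $ 1) =
      cls (- d) c (- b) a (j + d) (1 + phi - pt x 1 $ 2) (pt x 1 $ 1)" if "0 \<le> x" "x \<le> 1" for x
    using that turn_top[of x 1 a b c d j] phi_gt_1 by (simp add: turn_def)
qed (auto simp: turn_def)

lemma local_affine_unturn:
  "local_affine R_inv L_polygon (\<lambda>v. unturn a b c d (j, v)) (L_glued a b c d)"
proof (rule local_affine_L_right)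
  have "local_affine (mat 1 ** R_inv) (rect 0 1 0 phi)
      (\<lambda>v. glue_class (L_gluing a b c d) (j, R_inv *v v + pt 0 1)) (L_glued a b c d)"
    by (intro local_affine_compose[OF local_affine_glue_class])
      (auto simp: R_inv_def mat2_mult mem_rect mem_L_polygon)
  then show "local_affine R_inv (rect 0 1 0 phi) (\<lambda>v. cls a b c d j (v $ 2) (1 - v $ 1)) (L_glued a b c d)"
    by (simp add: R_inv_def mat2_mult pt_plus algebra_simps)
  have "local_affine (mat 1 ** R_inv) (rect 1 phi 0 1)
      (\<lambda>v. glue_class (L_gluing a b c d) (j - d, R_inv *v v + pt 0 (1 + phi))) (L_glued a b c d)"
    by (intro local_affine_compose[OF local_affine_glue_class])
      (auto simp: R_inv_def mat2_mult mem_rect mem_L_polygon)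
  then show "local_affine R_inv (rect 1 phi 0 1)
      (\<lambda>v. cls a b c d (j - d) (v $ 2) (1 + phi - v $ 1)) (L_glued a b c d)"
    by (simp add: R_inv_def mat2_mult pt_plus algebra_simps)
  show "cls a b c d j (pt 1 y $ 2) (1 - pt 1 y $ 1) =
      cls a b c d (j - d) (pt 1 y $ 2) (1 + phi - pt 1 y $ 1)" if "0 \<le> y" "y \<le> 1" for y
    using that unturn_right[of 1 y a b c d j] phi_gt_1 by (simp add: unturn_def)
qed (auto simp: unturn_def)

lemma unturn_turn:
  assumes "v \<in> L_polygon"
  shows "glue_lift (unturn a b c d) (turn a b c d (j, v)) = glue_class (L_gluing a b c d) (j, v)"
proof -
  define x y where "x = v $ 1" "y = v $ 2"
  have v: "v = pt x y" by (simp add: x_y_def pt_eta)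
  have xy: "0 \<le> x" "0 \<le> y" "\<not> y \<le> 1 \<Longrightarrow> x \<le> 1 \<and> y \<le> phi"
    using assms by (auto simp: mem_L_polygon x_y_def)
  then have "unturn a b c d (j + d, pt (1 + phi - y) x) = cls a b c d j x y" if "\<not> y \<le> 1"
    using that unturn_right[of "1 + phi - y" x a b c d "j + d"] by simp
  with xy show ?thesis
    by (cases "y \<le> 1")
      (simp_all add: v turn_pt glue_lift_class[OF glue_invariant_unturn], simp add: unturn_pt)
qed

lemma turn_unturn:
  assumes "v \<in> L_polygon"
  shows "glue_lift (turn a b c d) (unturn a b c d (j, v)) =
    glue_class (L_gluing (- d) c (- b) a) (j, v)"
proof -
  define x y where "x = v $ 1" "y = v $ 2"
  have v: "v = pt x y" by (simp add: x_y_def pt_eta)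
  have xy: "0 \<le> x" "0 \<le> y" "\<not> x \<le> 1 \<Longrightarrow> y \<le> 1 \<and> x \<le> phi"
    using assms by (auto simp: mem_L_polygon x_y_def)
  then have "turn a b c d (j - d, pt y (1 + phi - x)) = cls (- d) c (- b) a j x y" if "\<not> x \<le> 1"
    using that turn_top[of y "1 + phi - x" a b c d "j - d"] by simp
  with xy show ?thesis
    by (cases "x \<le> 1")
      (simp_all add: v unturn_pt glue_lift_class[OF glue_invariant_turn], simp add: turn_pt)
qed

proposition R_act: "translation_iso (matrix_act R_mat (L_glued a b c d)) (L_glued (- d) c (- b) a)"
proof (rule glued_translation_iso[OF _ _ R_inverse, where F = "glue_lift (turn a b c d)"
      and F' = "glue_lift (unturn a b c d)"])
qed (simp_all add: glue_lift_class[OF glue_invariant_turn] glue_lift_class[OF glue_invariant_unturn]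
    local_affine_turn local_affine_unturn turn_unturn unturn_turn)

section \<open>Relabelling the copies by a unit\<close>

lemma relabel:
  fixes u w :: "'i::comm_ring_1"
  assumes "u * w = 1"
  shows "translation_iso (L_glued a b c d) (L_glued (u * a) (u * b) (u * c) (u * d))"
proof -
  \<comment> \<open>All shifts and factors are allowed, since the inverse relabelling is the
    instance with factor \<open>w\<close> at the multiplied shifts.\<close>
  have inv: "glue_invariant (L_gluing p q r s)
      (\<lambda>(j, v). glue_class (L_gluing (z * p) (z * q) (z * r) (z * s)) (z * j, v))" for z p q r s :: 'i
    by (rule glue_invariant_L) (simp_all add: cls_A cls_B cls_C cls_D distrib_left)
  have uw: "u * (w * z) = z" "w * (u * z) = z" for z
    using assms by (simp_all add: mult.assoc[symmetric]) (simp add: mult.commute)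
  have "glue_invariant (L_gluing (u * a) (u * b) (u * c) (u * d))
      (\<lambda>(j, v). glue_class (L_gluing a b c d) (w * j, v))"
    using inv[of "u * a" "u * b" "u * c" "u * d" w] by (simp add: uw)
  note lift = glue_lift_class[OF inv[of a b c d u]] glue_lift_class[OF this]
  have "translation_iso (matrix_act (mat 1) (L_glued a b c d)) (L_glued (u * a) (u * b) (u * c) (u * d))"
    by (rule glued_translation_iso[where N = "mat 1"
          and F = "glue_lift (\<lambda>(j, v). glue_class (L_gluing (u * a) (u * b) (u * c) (u * d)) (u * j, v))"
          and F' = "glue_lift (\<lambda>(j, v). glue_class (L_gluing a b c d) (w * j, v))"])
      (simp_all add: lift uw local_affine_glue_class[where P = "\<lambda>_. L_polygon"])
  then show ?thesis by (simp add: matrix_act_one)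
qed

section \<open>Closed horizontal trajectories\<close>

text \<open>Asking for a chart at every time excludes singularities. Nothing is required at the
  closing point beyond \<open>\<gamma> 0 = \<gamma> l\<close>, as directions are globally defined on
  a translation surface. The length \<open>l\<close> need not be the first return time.\<close>

definition closed_horizontal :: "real \<Rightarrow> 'a surface \<Rightarrow> bool" where
  "closed_horizontal l X \<longleftrightarrow> (\<exists>\<gamma>. \<gamma> 0 = \<gamma> l \<and>
    (\<forall>t\<in>{0..l}. \<exists>U h e. (U, h) \<in> surf_charts X \<and> e > 0 \<and>
      (\<forall>s\<in>{0..l}. \<bar>s - t\<bar> < e \<longrightarrow> \<gamma> s \<in> U \<and> h (\<gamma> s) = h (\<gamma> t) + pt (s - t) 0)))"

text \<open>An isomorphism pulls charts of \<open>Y\<close> back to \<open>X\<close>, so the inverse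
  homeomorphism carries the curve from \<open>Y\<close> to \<open>X\<close>.\<close>

lemma closed_horizontal_iso:
  assumes "translation_iso X Y" "closed_horizontal l Y"
    and top: "\<And>V k. (V, k) \<in> surf_charts Y \<Longrightarrow> V \<subseteq> topspace (surf_top Y)"
  shows "closed_horizontal l X"
proof -
  obtain F where F: "homeomorphic_map (surf_top X) (surf_top Y) F"
    and F': "\<And>V k. V \<subseteq> topspace (surf_top Y) \<Longrightarrow> (V, k) \<in> surf_charts Y \<longleftrightarrow>
          ({p \<in> topspace (surf_top X). F p \<in> V}, k \<circ> F) \<in> surf_charts X"
    using assms(1) by (auto simp: translation_iso_def)
  obtain G where "homeomorphic_maps (surf_top X) (surf_top Y) F G"
    using F homeomorphic_map_maps by blast
  then have FG: "F (G q) = q" "G q \<in> topspace (surf_top X)" if "q \<in> topspace (surf_top Y)" for q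
    using that unfolding homeomorphic_maps_def continuous_map_def by auto
  obtain \<gamma> where \<gamma>: "\<gamma> 0 = \<gamma> l" "\<And>t. t \<in> {0..l} \<Longrightarrow> \<exists>U h e. (U, h) \<in> surf_charts Y \<and> e > 0 \<and>
      (\<forall>s\<in>{0..l}. \<bar>s - t\<bar> < e \<longrightarrow> \<gamma> s \<in> U \<and> h (\<gamma> s) = h (\<gamma> t) + pt (s - t) 0)"
    using assms(2) unfolding closed_horizontal_def by metis
  have "\<exists>U h e. (U, h) \<in> surf_charts X \<and> e > 0 \<and>
      (\<forall>s\<in>{0..l}. \<bar>s - t\<bar> < e \<longrightarrow> G (\<gamma> s) \<in> U \<and> h (G (\<gamma> s)) = h (G (\<gamma> t)) + pt (s - t) 0)"
    if t: "t \<in> {0..l}" for t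
  proof -
    obtain V k e where V: "(V, k) \<in> surf_charts Y" "e > 0"
      "\<And>s. s \<in> {0..l} \<Longrightarrow> \<bar>s - t\<bar> < e \<Longrightarrow> \<gamma> s \<in> V \<and> k (\<gamma> s) = k (\<gamma> t) + pt (s - t) 0"
      using \<gamma>(2)[OF t] by metis
    have "({p \<in> topspace (surf_top X). F p \<in> V}, k \<circ> F) \<in> surf_charts X"
      using F' top V(1) by blast
    moreover have "G (\<gamma> s) \<in> {p \<in> topspace (surf_top X). F p \<in> V} \<and>
        (k \<circ> F) (G (\<gamma> s)) = (k \<circ> F) (G (\<gamma> t)) + pt (s - t) 0"
      if s: "s \<in> {0..l}" "\<bar>s - t\<bar> < e" for s
    proof -
      have "\<gamma> s \<in> V" "\<gamma> t \<in> V" using V(2) V(3)[of s] V(3)[of t] s t by auto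
      moreover from this have "\<gamma> s \<in> topspace (surf_top Y)" "\<gamma> t \<in> topspace (surf_top Y)"
        using top[OF V(1)] by auto
      ultimately show ?thesis using FG V(3)[OF s] by simp
    qed
    ultimately show ?thesis using V(2) by blast
  qed
  then show ?thesis
    unfolding closed_horizontal_def using \<gamma>(1) by (intro exI[of _ "G \<circ> \<gamma>"]) simp
qed

text \<open>
  \<open>W\<close> is a window in the bottom cylinder of copy \<open>0\<close>, which closes up as \<open>a = 0\<close>: points of \<open>W\<close>
  with negative abscissa stand for their translates by \<open>phi\<close>.
\<close>

lemma cylinder_chart:
  fixes b c d :: "'i::ab_group_add"
  defines "g W \<equiv> \<lambda>(j, v). if j = (0::'i) \<and> v \<in> W then Some v
      else if j = 0 \<and> v - pt phi 0 \<in> W then Some (v - pt phi 0) else None"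
  assumes W: "open W" "\<And>v. v \<in> W \<Longrightarrow> - phi < v $ 1 \<and> v $ 1 < phi \<and> 0 < v $ 2 \<and> v $ 2 < 1"
    and wrap: "\<And>v. v \<in> W \<Longrightarrow> v + pt phi 0 \<notin> W"
  shows "glue_invariant (L_gluing 0 b c d) (g W)"
    and "({p \<in> topspace (glued_top (\<lambda>_. L_polygon) (L_gluing 0 b c d)). glue_lift (g W) p \<noteq> None},
      \<lambda>p. the (glue_lift (g W) p)) \<in> surf_charts (L_glued 0 b c d)"
proof -
  let ?G = "L_gluing 0 b c d" and ?X = "glued_top (\<lambda>_. L_polygon) (L_gluing 0 b c d)"
  let ?h = "\<lambda>p. the (glue_lift (g W) p)"
  \<comment> \<open>This is the inverse of the chart. As the shift through A is 0, adding one
    circumference does not change the point, but it brings abscissae from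
    \<open>(- phi, phi)\<close> into the range of \<open>bottom\<close>.\<close>
  let ?\<psi> = "\<lambda>v. bottom 0 b c d 0 (v $ 1 + phi) (v $ 2)"
  have out: "pt x y \<notin> W" if "\<not> (- phi < x \<and> x < phi \<and> 0 < y \<and> y < 1)" for x y
    using W(2)[of "pt x y"] that by auto
  show inv: "glue_invariant ?G (g W)"
    by (rule glue_invariant_L) (use phi_gt_1 in \<open>simp_all add: g_def out pt_minus\<close>)
  note lift = glue_lift_class[OF inv]
  have gW: "g W (j, v) = Some w \<longleftrightarrow> j = 0 \<and> w \<in> W \<and> (v = w \<or> v = w + pt phi 0)" for j v w
    using wrap[of w] by (auto simp: g_def algebra_simps)
  \<comment> \<open>Openness of \<open>U O'\<close> for every open \<open>O'\<close> inside
    \<open>W\<close> gives at once the openness of the domain \<open>U W\<close> and the continuity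
    of the coordinate.\<close>
  define U where "U O' = {p \<in> topspace ?X. \<exists>w\<in>O'. glue_lift (g W) p = Some w}" for O'
  have U: "openin ?X (U O')" if O': "open O'" "O' \<subseteq> W" for O'
  proof -
    have "{x \<in> L_polygon. glue_class ?G (i, x) \<in> U O'} =
        (if i = 0 then L_polygon \<inter> (O' \<union> (+) (pt phi 0) ` O') else {})" for i
      using O'(2) by (auto simp: U_def lift gW topspace_glued_top add.commute)
    moreover have "open (O' \<union> (+) (pt phi 0) ` O')"
      using O'(1) by (intro open_Un open_translation)
    ultimately show ?thesis
      unfolding openin_glued_top by (auto simp: U_def topspace_glued_top openin_open_Int)
  qed
  have UW: "U W = {p \<in> topspace ?X. glue_lift (g W) p \<noteq> None}"
    by (auto simp: U_def topspace_glued_top lift gW)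
  have \<psi>: "?\<psi> v \<in> U W" "glue_lift (g W) (?\<psi> v) = Some v" if "v \<in> W" for v
  proof -
    have "\<exists>x\<in>L_polygon. ?\<psi> v = glue_class ?G (0, x) \<and> (x = v \<or> x = v + pt phi 0)"
    proof (cases "v $ 1 \<le> 0")
      case True
      then show ?thesis
        using W(2)[OF that]
        by (intro bexI[of _ "pt (v $ 1 + phi) (v $ 2)"])
          (auto simp: bottom_def mem_L_polygon vec_eq_iff forall_2)
    next
      case False
      then show ?thesis
        using W(2)[OF that]
        by (intro bexI[of _ v]) (auto simp: bottom_def mem_L_polygon pt_eta)
    qed
    then show "?\<psi> v \<in> U W" "glue_lift (g W) (?\<psi> v) = Some v"
      using that by (auto simp: U_def topspace_glued_top lift gW)
  qed
  have \<psi>h: "?\<psi> (?h p) = p" if pU: "p \<in> U W" for p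
  proof -
    obtain w where w: "w \<in> W" "glue_lift (g W) p = Some w" "p \<in> topspace ?X"
      using pU by (auto simp: U_def)
    obtain i x where "p = glue_class ?G (i, x)" "x \<in> L_polygon"
      using w(3) by (auto simp: topspace_glued_top)
    with w(1,2) have p: "p = glue_class ?G (0, x)" "x \<in> L_polygon" "w \<in> W"
      "x = w \<or> x = w + pt phi 0"
      by (simp_all add: gW lift)
    have hp: "?h p = w" using w(2) by simp
    have w: "0 < w $ 2" "w $ 2 < 1" using W(2)[OF p(3)] by auto
    show ?thesis
    proof (cases "x = w")
      case True
      then show ?thesis
        using p hp w bottom_shift[of "w $ 1" "w $ 2" 0 b c d 0] by (simp add: mem_L_polygon pt_eta)
    next
      case False
      then have x: "x = w + pt phi 0" using p(4) by simp
      then have "x $ 1 = w $ 1 + phi" "x $ 2 = w $ 2" by simp_all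
      then have "x = pt (w $ 1 + phi) (w $ 2)" "w $ 1 + phi \<le> phi"
        using p(2) w phi_gt_1 by (auto simp: mem_L_polygon vec_eq_iff forall_2)
      then show ?thesis using p hp by (simp add: bottom_def)
    qed
  qed
  have hU: "?h ` U W = W"
  proof (intro equalityI subsetI)
    show "v \<in> W" if "v \<in> ?h ` U W" for v
      using that by (auto simp: U_def)
    show "v \<in> ?h ` U W" if "v \<in> W" for v
      using \<psi>[OF that] by (intro image_eqI[of v ?h "?\<psi> v"]) simp_all
  qed
  have "homeomorphic_maps (subtopology ?X (U W)) (top_of_set W) ?h ?\<psi>"
    unfolding homeomorphic_maps_def
  proof (intro conjI)
    show "continuous_map (subtopology ?X (U W)) (top_of_set W) ?h"
      unfolding continuous_map_def
    proof (intro conjI allI impI)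
      show "?h \<in> topspace (subtopology ?X (U W)) \<rightarrow> topspace (top_of_set W)"
        using hU by auto
      fix O' assume "openin (top_of_set W) O'"
      then have O': "open O'" "O' \<subseteq> W" using W(1) by (auto simp: openin_open_eq)
      have "{p \<in> topspace (subtopology ?X (U W)). ?h p \<in> O'} = U W \<inter> U O'"
        using O'(2) by (auto simp: U_def)
      then show "openin (subtopology ?X (U W)) {p \<in> topspace (subtopology ?X (U W)). ?h p \<in> O'}"
        using U[OF O'] by (simp add: openin_subtopology_Int2)
    qed
    have "local_affine (mat 1 ** mat 1) W (\<lambda>v. bottom 0 b c d 0 ((mat 1 *v v + pt phi 0) $ 1) ((mat 1 *v v + pt phi 0) $ 2))
        (L_glued 0 b c d)"
      using W(2) by (intro local_affine_compose[OF local_affine_bottom]) (force simp: mem_rect)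
    then have "continuous_map (top_of_set W) ?X ?\<psi>"
      using local_affine_continuous by fastforce
    then show "continuous_map (top_of_set W) (subtopology ?X (U W)) ?\<psi>"
      using \<psi>(1) by (auto simp: continuous_map_in_subtopology)
    show "\<forall>p\<in>topspace (subtopology ?X (U W)). ?\<psi> (?h p) = p" using \<psi>h by auto
    show "\<forall>v\<in>topspace (top_of_set W). ?h (?\<psi> v) = v" using \<psi>(2) by simp
  qed
  then have "homeomorphic_map (subtopology ?X (U W)) (top_of_set W) ?h"
    by (simp add: homeomorphic_maps_map)
  moreover have "\<exists>e>0. \<forall>y\<in>L_polygon \<inter> ball x e. glue_class ?G (i, y) \<in> U W \<longrightarrow>
      ?h (glue_class ?G (i, y)) = ?h (glue_class ?G (i, x)) + (y - x)"
    if x: "x \<in> L_polygon" "glue_class ?G (i, x) \<in> U W" for i x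
  proof -
    obtain w where w: "i = 0" "w \<in> W" "x = w \<or> x = w + pt phi 0" and g: "g W (i, x) = Some w"
      using x(2) by (auto simp: U_def lift gW)
    obtain e where e: "e > 0" "ball w e \<subseteq> W" using W(1) w(2) openE by blast
    have "g W (i, y) = Some (w + (y - x))" if "dist x y < e" for y
    proof -
      have "w + (y - x) \<in> ball w e" using that by (simp add: dist_norm norm_minus_commute)
      with e(2) w show ?thesis unfolding gW by auto
    qed
    then show ?thesis
      using e(1) g by (intro exI[of _ e]) (simp add: lift)
  qed
  ultimately have "(U W, ?h) \<in> surf_charts (L_glued 0 b c d)"
    unfolding charts_glued hU using U[OF W(1) subset_refl] W(1) by blast
  then show "({p \<in> topspace ?X. glue_lift (g W) p \<noteq> None}, ?h) \<in> surf_charts (L_glued 0 b c d)"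
    by (simp only: UW)
qed

text \<open>The curve is the core of the bottom cylinder of copy 0. Two windows suffice: abscissae
  in \<open>(0, phi)\<close> away from the seam, and in \<open>(- phi / 2, phi / 2)\<close> at the
  seam.\<close>

lemma closed_horizontal_L_glued: "closed_horizontal phi (L_glued 0 b c d)"
proof -
  let ?X = "glued_top (\<lambda>_. L_polygon) (L_gluing 0 b c d)"
  let ?\<gamma> = "\<lambda>t. cls 0 b c d 0 t (1/2)"
  let ?g = "\<lambda>W (j, v). if j = 0 \<and> v \<in> W then Some v
      else if j = 0 \<and> v - pt phi 0 \<in> W then Some (v - pt phi 0) else None"
  define W where "W x1 x2 = {v :: plane. x1 < v $ 1 \<and> v $ 1 < x2 \<and> 0 < v $ 2 \<and> v $ 2 < 1}" for x1 x2
  have open_W: "open (W x1 x2)" for x1 x2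
    unfolding W_def by (intro open_Collect_conj open_Collect_less continuous_intros)
  have L: "?\<gamma> t \<in> topspace ?X" if "t \<in> {0..phi}" for t
    using that by (auto simp: topspace_glued_top mem_L_polygon intro!: image_eqI)
  \<comment> \<open>\<open>r\<close> is the difference between parameter and coordinate: near its
    end the curve appears in the window at abscissa \<open>s - phi\<close>. A width of at most
    \<open>phi\<close> keeps the window disjoint from its translate.\<close>
  have chart: "\<exists>U h e. (U, h) \<in> surf_charts (L_glued 0 b c d) \<and> e > 0 \<and>
      (\<forall>s\<in>{0..phi}. \<bar>s - t\<bar> < e \<longrightarrow> ?\<gamma> s \<in> U \<and> h (?\<gamma> s) = h (?\<gamma> t) + pt (s - t) 0)"
    if "- phi \<le> x1" "x2 \<le> phi" "x2 - x1 \<le> phi" "e > 0" and t: "t \<in> {0..phi}"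
      and off: "\<And>s. s \<in> {0..phi} \<Longrightarrow> \<bar>s - t\<bar> < e \<Longrightarrow> x1 < s - r \<and> s - r < x2" "r = 0 \<or> r = phi"
    for x1 x2 e t r
  proof -
    have 1: "- phi < v $ 1 \<and> v $ 1 < phi \<and> 0 < v $ 2 \<and> v $ 2 < 1" "v + pt phi 0 \<notin> W x1 x2"
      if "v \<in> W x1 x2" for v
      using that \<open>- phi \<le> x1\<close> \<open>x2 \<le> phi\<close> \<open>x2 - x1 \<le> phi\<close> by (auto simp: W_def)
    note c = cylinder_chart[OF open_W[of x1 x2] 1, of b c d]
    have *: "glue_lift (?g (W x1 x2)) (?\<gamma> s) = Some (pt (s - r) (1/2))"
      if "s \<in> {0..phi}" "\<bar>s - t\<bar> < e" for s
      using off(1)[OF that] off(2) that(1) \<open>x2 - x1 \<le> phi\<close> \<open>x2 \<le> phi\<close>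
      by (subst glue_lift_class[OF c(1)]) (auto simp: W_def pt_minus)
    show ?thesis
      using c(2) \<open>e > 0\<close> L t *[of t]
      by (intro exI conjI) (assumption, assumption, auto simp: * pt_plus)
  qed
  have "\<exists>U h e. (U, h) \<in> surf_charts (L_glued 0 b c d) \<and> e > 0 \<and>
      (\<forall>s\<in>{0..phi}. \<bar>s - t\<bar> < e \<longrightarrow> ?\<gamma> s \<in> U \<and> h (?\<gamma> s) = h (?\<gamma> t) + pt (s - t) 0)"
    if t: "t \<in> {0..phi}" for t
  proof -
    consider "t = 0" | "t = phi" | "0 < t" "t < phi" using t by force
    then show ?thesis
    proof cases
      case 1
      then show ?thesis using t phi_gt_1
        by (intro chart[of "- phi / 2" "phi / 2" "phi / 2" t 0]) auto
    next
      case 2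
      then show ?thesis using t phi_gt_1
        by (intro chart[of "- phi / 2" "phi / 2" "phi / 2" t phi]) auto
    next
      case 3
      then show ?thesis using t phi_gt_1
        by (intro chart[of 0 phi "min t (phi - t)" t 0]) auto
    qed
  qed
  moreover have "?\<gamma> 0 = ?\<gamma> phi" by (simp add: cls_A)
  ultimately show ?thesis
    unfolding closed_horizontal_def by (intro exI[of _ ?\<gamma>] conjI ballI)
qed

section \<open>Vertices and horizontal directions in an arbitrary chart\<close>

lemma chart_near:
  assumes "(U, h) \<in> surf_charts (glued_surface P G)" "x \<in> P i" "glue_class G (i, x) \<in> U"
  obtains e where "e > 0" "\<And>y. y \<in> P i \<Longrightarrow> dist x y < e \<Longrightarrow>
    glue_class G (i, y) \<in> U \<and> h (glue_class G (i, y)) = h (glue_class G (i, x)) + (y - x)"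
proof -
  have "\<exists>e>0. \<forall>y\<in>P i \<inter> ball x e. glue_class G (i, y) \<in> U \<longrightarrow>
      h (glue_class G (i, y)) = h (glue_class G (i, x)) + (y - x)"
    using assms by (simp add: charts_glued)
  then obtain e1 where e1: "e1 > 0" "\<forall>y\<in>P i \<inter> ball x e1. glue_class G (i, y) \<in> U \<longrightarrow>
      h (glue_class G (i, y)) = h (glue_class G (i, x)) + (y - x)"
    by blast
  have "openin (top_of_set (P i)) {y \<in> P i. glue_class G (i, y) \<in> U}"
    using assms(1) by (simp add: charts_glued openin_glued_top)
  then obtain e2 where "e2 > 0" "ball x e2 \<inter> P i \<subseteq> {y \<in> P i. glue_class G (i, y) \<in> U}"
    using assms(2,3) unfolding openin_contains_ball by blast
  with e1 show ?thesis by (intro that[of "min e1 e2"]) auto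
qed

lemma chart_inj:
  assumes "(U, h) \<in> surf_charts (glued_surface P G)" "p \<in> U" "q \<in> U" "h p = h q"
  shows "p = q"
proof -
  have "U \<subseteq> topspace (glued_top P G)"
    using assms(1) openin_subset by (auto simp: charts_glued)
  then have "inj_on h U"
    using assms(1) by (auto simp: charts_glued homeomorphic_map_def Int_absorb1)
  with assms show ?thesis by (auto dest: inj_onD)
qed

text \<open>
  The north-west quadrant occurs twice around the vertex: at the reflex corner \<open>(1, 1)\<close> of one
  copy and at \<open>(1, 0)\<close> in another. So no chart is injective there.
\<close>

lemma vertex_not_in_chart:
  assumes "(U, h) \<in> surf_charts (L_glued a b c d)"
  shows "cls a b c d j 1 1 \<notin> U"
proof
  let ?G = "L_gluing a b c d"
  assume U: "cls a b c d j 1 1 \<in> U"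
  have eq: "cls a b c d j 1 1 = cls a b c d (j + b) 1 0"
    using phi_gt_1 by (simp add: cls_B)
  obtain e1 where e1: "e1 > 0" "\<And>y. y \<in> L_polygon \<Longrightarrow> dist (pt 1 1) y < e1 \<Longrightarrow>
      glue_class ?G (j, y) \<in> U \<and> h (glue_class ?G (j, y)) = h (cls a b c d j 1 1) + (y - pt 1 1)"
    using chart_near[OF assms, of "pt 1 1" j] U phi_gt_1 by (auto simp: mem_L_polygon)
  obtain e2 where e2: "e2 > 0" "\<And>y. y \<in> L_polygon \<Longrightarrow> dist (pt 1 0) y < e2 \<Longrightarrow>
      glue_class ?G (j + b, y) \<in> U \<and>
      h (glue_class ?G (j + b, y)) = h (cls a b c d (j + b) 1 0) + (y - pt 1 0)"
    using chart_near[OF assms, of "pt 1 0" "j + b"] U phi_gt_1 by (auto simp: mem_L_polygon eq)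
  \<comment> \<open>The diagonal step has length at most \<open>2 * \<delta>\<close>, hence the
    quarters; the last bound keeps \<open>1 + \<delta>\<close> below \<open>phi\<close>.\<close>
  define \<delta> where "\<delta> = min (e1 / 4) (min (e2 / 4) ((phi - 1) / 2))"
  have \<delta>: "0 < \<delta>" "\<delta> \<le> e1 / 4" "\<delta> \<le> e2 / 4" "\<delta> \<le> (phi - 1) / 2"
  proof -
    show "0 < \<delta>" using e1(1) e2(1) phi_gt_1 by (simp add: \<delta>_def)
    show "\<delta> \<le> e1 / 4" unfolding \<delta>_def by (rule min.cobounded1)
    show "\<delta> \<le> e2 / 4" unfolding \<delta>_def by (rule min.coboundedI2[OF min.cobounded1])
    show "\<delta> \<le> (phi - 1) / 2" unfolding \<delta>_def by (rule min.coboundedI2[OF min.cobounded2])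
  qed
  then have "\<delta> < 1" using phi_less_2 by simp
  have dist: "dist (pt x y) (pt (x - \<delta>) (y + \<delta>)) \<le> 2 * \<delta>" for x y
    using norm_le_l1_cart[of "pt x y - pt (x - \<delta>) (y + \<delta>)"] \<delta>(1)
    by (simp add: dist_norm sum_2)
  have 1: "cls a b c d j (1 - \<delta>) (1 + \<delta>) \<in> U \<and>
      h (cls a b c d j (1 - \<delta>) (1 + \<delta>)) = h (cls a b c d j 1 1) + pt (- \<delta>) \<delta>"
    using e1(2)[of "pt (1 - \<delta>) (1 + \<delta>)"] dist[of 1 1] \<delta> \<open>\<delta> < 1\<close> e1(1) by (auto simp: mem_L_polygon pt_minus)
  have 2: "cls a b c d (j + b) (1 - \<delta>) \<delta> \<in> U \<and>
      h (cls a b c d (j + b) (1 - \<delta>) \<delta>) = h (cls a b c d (j + b) 1 0) + pt (- \<delta>) \<delta>"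
    using e2(2)[of "pt (1 - \<delta>) \<delta>"] dist[of 1 0] \<delta> \<open>\<delta> < 1\<close> e2(1) phi_gt_1 by (auto simp: mem_L_polygon pt_minus)
  have same: "cls a b c d j (1 - \<delta>) (1 + \<delta>) = cls a b c d (j + b) (1 - \<delta>) \<delta>"
    using 1 2 by (intro chart_inj[OF assms]) (simp_all add: eq)
  \<comment> \<open>The two points lie at heights \<open>1 + \<delta>\<close> and
    \<open>\<delta>\<close>; lying in the open bottom cylinder is invariant under the gluing and
    tells them apart.\<close>
  have "glue_invariant ?G (\<lambda>(i, v). 0 < v $ 2 \<and> v $ 2 < 1)"
    using phi_gt_1 by (intro glue_invariant_L) auto
  from glue_invariant_class[OF this same] \<delta>(1) \<open>\<delta> < 1\<close> show False by simp
qed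

text \<open>A chain of gluings joins each vertex to the reflex corner (1, 1) of some copy: (1, 0)
  through B, (1, phi) through D, (0, 1) and (0, phi) through C, (0, 0) through D, and (phi, 0) and
  (phi, 1) through A. The remaining combination (phi, phi) is outside the polygon.\<close>

lemma vertex_class:
  assumes "pt x y \<in> L_polygon" "x \<in> {0, 1, phi}" "y \<in> {0, 1, phi}"
  shows "\<exists>k. cls a b c d j x y = cls a b c d k 1 1"
proof -
  have v10: "cls a b c d i 1 0 = cls a b c d (i - b) 1 1" for i
    using phi_gt_1 by (simp add: cls_B)
  have v1p: "cls a b c d i 1 phi = cls a b c d (i + d - b) 1 1" for i
    by (simp add: cls_D v10)
  have v01: "cls a b c d i 0 1 = cls a b c d (i - c) 1 1" for i
    using phi_gt_1 by (simp add: cls_C)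
  have v0p: "cls a b c d i 0 phi = cls a b c d (i - c + d - b) 1 1" for i
    using phi_gt_1 cls_C[of phi a b c d "i - c"] by (simp add: v1p)
  have v00: "cls a b c d i 0 0 = cls a b c d (i - d - c + d - b) 1 1" for i
    using cls_D[of 0 a b c d "i - d"] by (simp add: v0p)
  have vp0: "cls a b c d i phi 0 = cls a b c d (i + a - d - c + d - b) 1 1" for i
    using cls_A[of 0 a b c d i] by (simp add: v00)
  have vp1: "cls a b c d i phi 1 = cls a b c d (i + a - c) 1 1" for i
    using cls_A[of 1 a b c d i] by (simp add: v01)
  have "(x, y) \<noteq> (phi, phi)"
    using assms(1) phi_gt_1 by (auto simp: mem_L_polygon)
  with assms(2,3) show ?thesis
    by (auto simp: v10 v1p v01 v0p v00 vp0 vp1)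
qed

text \<open>A point on A or C has no room to its right in its own copy, and is replaced by its
  partner on the opposite side.\<close>

lemma right_germ:
  assumes "v \<in> L_polygon"
  obtains k x y e where "pt x y \<in> L_polygon" "glue_class (L_gluing a b c d) (j, v) = cls a b c d k x y"
    "e > 0" "\<And>r. 0 \<le> r \<Longrightarrow> r < e \<Longrightarrow> pt (x + r) y \<in> L_polygon"
proof -
  define x y where "x = v $ 1" "y = v $ 2"
  have v: "v = pt x y" by (simp add: x_y_def pt_eta)
  have xy: "0 \<le> x" "0 \<le> y" "x \<le> phi \<and> y \<le> 1 \<or> x \<le> 1 \<and> y \<le> phi"
    using assms by (auto simp: mem_L_polygon x_y_def)
  consider "x < phi" "y \<le> 1" | "x = phi" "y \<le> 1" | "x < 1" "1 < y" | "x = 1" "1 < y"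
    using xy phi_gt_1 by fastforce
  then show ?thesis
  proof cases
    case 1
    then show ?thesis
      using xy by (intro that[of x y j "phi - x"]) (auto simp: v mem_L_polygon)
  next
    case 2
    then show ?thesis
      using xy phi_gt_1 by (intro that[of 0 y "j + a" phi]) (auto simp: v mem_L_polygon cls_A)
  next
    case 3
    then show ?thesis
      using xy by (intro that[of x y j "1 - x"]) (auto simp: v mem_L_polygon)
  next
    case 4
    then show ?thesis
      using xy by (intro that[of 0 y "j + c" 1]) (auto simp: v mem_L_polygon cls_C)
  qed
qed

lemma left_germ:
  assumes "v \<in> L_polygon"
  obtains k x y e where "pt x y \<in> L_polygon" "glue_class (L_gluing a b c d) (j, v) = cls a b c d k x y"
    "e > 0" "\<And>r. - e < r \<Longrightarrow> r \<le> 0 \<Longrightarrow> pt (x + r) y \<in> L_polygon"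
proof -
  define x y where "x = v $ 1" "y = v $ 2"
  have v: "v = pt x y" by (simp add: x_y_def pt_eta)
  have xy: "0 \<le> x" "0 \<le> y" "x \<le> phi \<and> y \<le> 1 \<or> x \<le> 1 \<and> y \<le> phi"
    using assms by (auto simp: mem_L_polygon x_y_def)
  consider "0 < x" | "x = 0" "y \<le> 1" | "x = 0" "1 < y"
    using xy by fastforce
  then show ?thesis
  proof cases
    case 1
    then show ?thesis
      using xy by (intro that[of x y j x]) (auto simp: v mem_L_polygon)
  next
    case 2
    then show ?thesis
      using xy phi_gt_1 by (intro that[of phi y "j - a" phi]) (auto simp: v mem_L_polygon cls_A)
  next
    case 3
    then show ?thesis
      using xy phi_gt_1 by (intro that[of 1 y "j - c" 1]) (auto simp: v mem_L_polygon cls_C)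
  qed
qed

text \<open>The sign of \<open>r\<close> decides which representative of \<open>p\<close> has room
  for the step. The polygon point reached has the same chart value as \<open>q\<close>, so
  injectivity of the chart identifies them.\<close>

lemma horizontal_step:
  assumes "(U, h) \<in> surf_charts (L_glued a b c d)" "p \<in> U"
  obtains e where "e > 0" "\<And>r q. \<bar>r\<bar> < e \<Longrightarrow> q \<in> U \<Longrightarrow> h q = h p + pt r 0 \<Longrightarrow>
    \<exists>k x y. pt x y \<in> L_polygon \<and> pt (x + r) y \<in> L_polygon \<and>
      p = cls a b c d k x y \<and> q = cls a b c d k (x + r) y"
proof -
  let ?G = "L_gluing a b c d"
  have near: "\<exists>e>0. \<forall>r q. \<bar>r\<bar> < e \<and> q \<in> U \<and> h q = h p + pt r 0 \<and> pt (x + r) y \<in> L_polygon \<longrightarrow>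
      q = cls a b c d k (x + r) y"
    if xy: "pt x y \<in> L_polygon" "p = cls a b c d k x y" for k x y
  proof -
    obtain e where e: "e > 0" "\<And>w. w \<in> L_polygon \<Longrightarrow> dist (pt x y) w < e \<Longrightarrow>
        glue_class ?G (k, w) \<in> U \<and> h (glue_class ?G (k, w)) = h p + (w - pt x y)"
      using chart_near[OF assms(1), of "pt x y" k] xy assms(2) by metis
    have "q = cls a b c d k (x + r) y"
      if "\<bar>r\<bar> < e" "q \<in> U" "h q = h p + pt r 0" "pt (x + r) y \<in> L_polygon" for r q
    proof -
      have "dist (pt x y) (pt (x + r) y) \<le> \<bar>r\<bar>"
        using norm_le_l1_cart[of "pt x y - pt (x + r) y"] by (simp add: dist_norm sum_2)
      then show ?thesis
        using e(2)[OF that(4)] that by (intro chart_inj[OF assms(1)]) (auto simp: pt_minus)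
    qed
    with e(1) show ?thesis by blast
  qed
  have "p \<in> topspace (glued_top (\<lambda>_. L_polygon) ?G)"
    using assms openin_subset by (auto simp: charts_glued)
  then obtain j v where v: "v \<in> L_polygon" "p = glue_class ?G (j, v)"
    by (auto simp: topspace_glued_top)
  obtain k x y e where R: "pt x y \<in> L_polygon" "p = cls a b c d k x y" "e > 0"
    "\<And>r. 0 \<le> r \<Longrightarrow> r < e \<Longrightarrow> pt (x + r) y \<in> L_polygon"
    using right_germ[OF v(1)] v(2) by metis
  obtain k' x' y' e' where L: "pt x' y' \<in> L_polygon" "p = cls a b c d k' x' y'" "e' > 0"
    "\<And>r. - e' < r \<Longrightarrow> r \<le> 0 \<Longrightarrow> pt (x' + r) y' \<in> L_polygon"
    using left_germ[OF v(1)] v(2) by metis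
  obtain e1 where e1: "e1 > 0" "\<And>r q. \<bar>r\<bar> < e1 \<Longrightarrow> q \<in> U \<Longrightarrow> h q = h p + pt r 0 \<Longrightarrow>
      pt (x + r) y \<in> L_polygon \<Longrightarrow> q = cls a b c d k (x + r) y"
    using near[OF R(1,2)] by blast
  obtain e2 where e2: "e2 > 0" "\<And>r q. \<bar>r\<bar> < e2 \<Longrightarrow> q \<in> U \<Longrightarrow> h q = h p + pt r 0 \<Longrightarrow>
      pt (x' + r) y' \<in> L_polygon \<Longrightarrow> q = cls a b c d k' (x' + r) y'"
    using near[OF L(1,2)] by blast
  show ?thesis
  proof (rule that[of "Min {e, e', e1, e2}"])
    show "Min {e, e', e1, e2} > 0" using R(3) L(3) e1(1) e2(1) by simp
    fix r q assume rq: "\<bar>r\<bar> < Min {e, e', e1, e2}" "q \<in> U" "h q = h p + pt r 0"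
    show "\<exists>k x y. pt x y \<in> L_polygon \<and> pt (x + r) y \<in> L_polygon \<and>
        p = cls a b c d k x y \<and> q = cls a b c d k (x + r) y"
    proof (cases "r \<ge> 0")
      case True
      then have "pt (x + r) y \<in> L_polygon" using R(4) rq(1) by simp
      with R e1(2)[of r q] rq show ?thesis by auto
    next
      case False
      then have "pt (x' + r) y' \<in> L_polygon" using L(4) rq(1) by simp
      with L e2(2)[of r q] rq show ?thesis by auto
    qed
  qed
qed

text \<open>Compensating the phase makes
  \<open>cis (- \<kappa> * t) * glue_lift f (\<gamma> t)\<close> locally constant, hence constant,
  and closing up after \<open>l\<close> forces the value to be fixed by a factor different from 1.
  The phase rule is asked only off the vertices, which the trajectory avoids; this permits functions
  that are cut off to 0 at vertices.\<close>

lemma phase_zero: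
  fixes f :: "'i::ab_group_add \<times> plane \<Rightarrow> complex"
  assumes inv: "glue_invariant (L_gluing a b c d) f"
    and phase: "\<And>j x y r. pt x y \<in> L_polygon \<Longrightarrow> pt (x + r) y \<in> L_polygon \<Longrightarrow>
      \<not> (x \<in> {0, 1, phi} \<and> y \<in> {0, 1, phi}) \<Longrightarrow> \<not> (x + r \<in> {0, 1, phi} \<and> y \<in> {0, 1, phi}) \<Longrightarrow>
      f (j, pt (x + r) y) = cis (\<kappa> * r) * f (j, pt x y)"
    and \<kappa>: "0 < \<kappa> * l" "\<kappa> * l < 2 * pi" and l: "0 \<le> l"
    and closed: "\<gamma> 0 = \<gamma> l"
    and traj: "\<And>t. t \<in> {0..l} \<Longrightarrow> \<exists>U h e. (U, h) \<in> surf_charts (L_glued a b c d) \<and> e > 0 \<and>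
      (\<forall>s\<in>{0..l}. \<bar>s - t\<bar> < e \<longrightarrow> \<gamma> s \<in> U \<and> h (\<gamma> s) = h (\<gamma> t) + pt (s - t) 0)"
  shows "glue_lift f (\<gamma> 0) = 0"
proof -
  define w where "w t = cis (- \<kappa> * t) * glue_lift f (\<gamma> t)" for t
  have "w constant_on {0..l}"
  proof (rule locally_constant_imp_constant)
    fix t assume t: "t \<in> {0..l}"
    obtain U h e1 where U: "(U, h) \<in> surf_charts (L_glued a b c d)" "e1 > 0"
      "\<And>s. s \<in> {0..l} \<Longrightarrow> \<bar>s - t\<bar> < e1 \<Longrightarrow> \<gamma> s \<in> U \<and> h (\<gamma> s) = h (\<gamma> t) + pt (s - t) 0"
      using traj[OF t] by metis
    have tU: "\<gamma> t \<in> U" using U(2) U(3)[OF t] by simp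
    obtain e2 where e2: "e2 > 0" "\<And>r q. \<bar>r\<bar> < e2 \<Longrightarrow> q \<in> U \<Longrightarrow> h q = h (\<gamma> t) + pt r 0 \<Longrightarrow>
        \<exists>k x y. pt x y \<in> L_polygon \<and> pt (x + r) y \<in> L_polygon \<and>
        \<gamma> t = cls a b c d k x y \<and> q = cls a b c d k (x + r) y"
      using horizontal_step[OF U(1) tU] by metis
    have "w s = w t" if s: "s \<in> {0..l}" "\<bar>s - t\<bar> < min e1 e2" for s
    proof -
      have sU: "\<gamma> s \<in> U" "h (\<gamma> s) = h (\<gamma> t) + pt (s - t) 0"
        using U(3)[of s] s by auto
      then obtain k x y where kxy: "pt x y \<in> L_polygon" "pt (x + (s - t)) y \<in> L_polygon"
        "\<gamma> t = cls a b c d k x y" "\<gamma> s = cls a b c d k (x + (s - t)) y"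
        using e2(2)[of "s - t" "\<gamma> s"] s by auto
      have "\<not> (x \<in> {0, 1, phi} \<and> y \<in> {0, 1, phi})"
        using vertex_class[OF kxy(1), of a b c d k] vertex_not_in_chart[OF U(1)] tU kxy(3) by metis
      moreover have "\<not> (x + (s - t) \<in> {0, 1, phi} \<and> y \<in> {0, 1, phi})"
        using vertex_class[OF kxy(2), of a b c d k] vertex_not_in_chart[OF U(1)] sU(1) kxy(4) by metis
      ultimately have "glue_lift f (\<gamma> s) = cis (\<kappa> * (s - t)) * glue_lift f (\<gamma> t)"
        using phase[OF kxy(1,2)] by (simp add: kxy(3,4) glue_lift_class[OF inv])
      moreover have "cis (- \<kappa> * s) * cis (\<kappa> * (s - t)) = cis (- \<kappa> * t)"
        by (simp add: cis_mult algebra_simps)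
      ultimately show ?thesis by (simp add: w_def mult.assoc[symmetric])
    qed
    then have "\<forall>s\<in>{0..l} \<inter> ball t (min e1 e2). w s = w t"
      by (simp add: dist_real_def abs_minus_commute)
    moreover have "t \<in> {0..l} \<inter> ball t (min e1 e2)"
      using t U(2) e2(1) by simp
    ultimately show "\<exists>T. openin (top_of_set {0..l}) T \<and> t \<in> T \<and> (\<forall>s\<in>T. w s = w t)"
      using openin_open_Int[OF open_ball] by metis
  qed simp
  then have "w 0 = w l" using l by (auto simp: constant_on_def)
  then have "glue_lift f (\<gamma> 0) = cis (- \<kappa> * l) * glue_lift f (\<gamma> 0)"
    by (simp add: w_def closed)
  moreover have "cis (- \<kappa> * l) \<noteq> 1"
  proof
    assume "cis (- \<kappa> * l) = 1"
    then have "cos (\<kappa> * l) = 1" by (simp add: complex_eq_iff)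
    then obtain n :: int where "\<kappa> * l = real_of_int n * 2 * pi" using cos_one_2pi_int by blast
    with \<kappa> have "0 < real_of_int n" "real_of_int n < 1"
      by (simp_all add: zero_less_mult_iff)
    then show False by simp
  qed
  ultimately show ?thesis by (metis mult_cancel_right1)
qed

text \<open>The character of the integers modulo 5 given by a primitive fifth root of unity;
  \<open>Rep_bit1\<close> is the representative among 0, ..., 4.\<close>

definition character5 :: "5 \<Rightarrow> complex" where
  "character5 j = cis (2 * pi / 5 * Rep_bit1 j)"

lemma character5_1: "character5 1 = cis (2 * pi / 5)"
  by (simp add: character5_def bit1.Rep_1)

text \<open>Representatives add up to a multiple of 5, which changes the argument of
  \<open>cis\<close> by a multiple of \<open>2 * pi\<close>.\<close>

lemma character5_add: "character5 (j + k) = character5 j * character5 k"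
proof -
  have "Rep_bit1 (j + k) = (Rep_bit1 j + Rep_bit1 k) mod int CARD(5)"
    by (simp only: bit1.add_def bit1.Rep_Abs_mod)
  then have "Rep_bit1 j + Rep_bit1 k = Rep_bit1 (j + k) + 5 * ((Rep_bit1 j + Rep_bit1 k) div 5)"
    by simp
  then have eq: "real_of_int (Rep_bit1 j + Rep_bit1 k) =
      real_of_int (Rep_bit1 (j + k)) + 5 * real_of_int ((Rep_bit1 j + Rep_bit1 k) div 5)"
    by (metis of_int_add of_int_mult of_int_numeral)
  have "2 * pi / 5 * Rep_bit1 j + 2 * pi / 5 * Rep_bit1 k =
      2 * pi / 5 * real_of_int (Rep_bit1 j + Rep_bit1 k)"
    by (simp add: distrib_left)
  also have "\<dots> = 2 * pi / 5 * Rep_bit1 (j + k) + 2 * pi * real_of_int ((Rep_bit1 j + Rep_bit1 k) div 5)"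
    unfolding eq by (simp add: distrib_left)
  finally have "2 * pi / 5 * Rep_bit1 j + 2 * pi / 5 * Rep_bit1 k = \<dots>" .
  then show ?thesis
    by (simp add: character5_def cis_mult) (simp add: cis_mult[symmetric] cis_multiple_2pi)
qed

text \<open>Three phase functions vanish at the starting point. Their supports cover the polygon
  except for the vertices, so that point would be a vertex, which lies in no chart.\<close>

lemma no_closed_horizontal: "\<not> closed_horizontal phi (L_glued (1 :: 5) 0 2 0)"
proof
  let ?G = "L_gluing (1 :: 5) 0 2 0"
  assume "closed_horizontal phi (L_glued (1 :: 5) 0 2 0)"
  then obtain \<gamma> where \<gamma>: "\<gamma> 0 = \<gamma> phi" "\<And>t. t \<in> {0..phi} \<Longrightarrow>
      \<exists>U h e. (U, h) \<in> surf_charts (L_glued (1 :: 5) 0 2 0) \<and> e > 0 \<and>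
      (\<forall>s\<in>{0..phi}. \<bar>s - t\<bar> < e \<longrightarrow> \<gamma> s \<in> U \<and> h (\<gamma> s) = h (\<gamma> t) + pt (s - t) 0)"
    unfolding closed_horizontal_def by metis
  have phi: "0 \<le> phi" "phi > 0" "phi \<noteq> 0" using phi_gt_1 by auto
  txt \<open>
    \<open>f1\<close> and \<open>f2\<close> are phases along the two long cylinders, of circumference \<open>5 * phi\<close> and \<open>5\<close>;
    as \<open>3\<close> is inverse to \<open>c = 2\<close>, the copy \<open>j\<close> is at position \<open>3 * j\<close> on the second one.
    \<open>f3\<close> handles the horizontal segments between vertices.
  \<close>
  define f1 :: "5 \<times> plane \<Rightarrow> complex" where "f1 = (\<lambda>(j, v).
    if 0 < v $ 2 \<and> v $ 2 < 1 then character5 j * cis (2 * pi / 5 / phi * v $ 1) else 0)"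
  define f2 :: "5 \<times> plane \<Rightarrow> complex" where "f2 = (\<lambda>(j, v).
    if 1 < v $ 2 \<and> v $ 2 < phi then character5 (3 * j) * cis (2 * pi / 5 * v $ 1) else 0)"
  define f3 :: "5 \<times> plane \<Rightarrow> complex" where "f3 = (\<lambda>(j, v).
    if v $ 2 \<in> {0, 1, phi} \<and> v $ 1 \<notin> {0, 1, phi} then cis (2 * pi / 5 * v $ 1) else 0)"
  have inv1: "glue_invariant ?G f1"
    using phi_gt_1 by (intro glue_invariant_L) (auto simp: f1_def character5_add character5_1)
  \<comment> \<open>Crossing C changes \<open>3 * j\<close> by \<open>3 * 2 = 6\<close>, which is 1
    modulo 5 and compensates the drop of the abscissa from 1 to 0.\<close>
  have "character5 6 = character5 1" by (rule arg_cong[of _ _ character5]) simp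
  then have inv2: "glue_invariant ?G f2"
    using phi_gt_1 by (intro glue_invariant_L) (auto simp: f2_def distrib_left character5_add character5_1)
  have inv3: "glue_invariant ?G f3"
    using phi_gt_1 by (intro glue_invariant_L) (auto simp: f3_def)
  \<comment> \<open>Over the length \<open>phi\<close> the phase of \<open>f1\<close> grows by
    \<open>2 * pi / 5\<close>, those of \<open>f2\<close> and \<open>f3\<close> by
    \<open>2 * pi / 5 * phi\<close>; all are positive and less than a full turn.\<close>
  have "glue_lift f1 (\<gamma> 0) = 0"
    by (rule phase_zero[OF inv1 _ _ _ phi(1) \<gamma>, where \<kappa> = "2 * pi / 5 / phi"])
      (use phi in \<open>auto simp: f1_def cis_mult field_simps\<close>)
  moreover have "glue_lift f2 (\<gamma> 0) = 0"
    by (rule phase_zero[OF inv2 _ _ _ phi(1) \<gamma>, where \<kappa> = "2 * pi / 5"])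
      (use phi phi_less_2 in \<open>auto simp: f2_def cis_mult field_simps\<close>)
  moreover have "glue_lift f3 (\<gamma> 0) = 0"
    by (rule phase_zero[OF inv3 _ _ _ phi(1) \<gamma>, where \<kappa> = "2 * pi / 5"])
      (use phi phi_less_2 in \<open>auto simp: f3_def cis_mult field_simps\<close>)
  moreover obtain U h where U: "(U, h) \<in> surf_charts (L_glued (1 :: 5) 0 2 0)" "\<gamma> 0 \<in> U"
    using \<gamma>(2)[of 0] phi by force
  have "openin (glued_top (\<lambda>_. L_polygon) ?G) U" using U(1) by (simp add: charts_glued)
  from subsetD[OF openin_subset[OF this] U(2)]
  obtain j v where v: "v \<in> L_polygon" "\<gamma> 0 = glue_class ?G (j, v)"
    by (auto simp: topspace_glued_top)
  ultimately have "f1 (j, v) = 0" "f2 (j, v) = 0" "f3 (j, v) = 0"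
    by (simp_all add: glue_lift_class[OF inv1] glue_lift_class[OF inv2] glue_lift_class[OF inv3])
  then have "v $ 1 \<in> {0, 1, phi}" "v $ 2 \<in> {0, 1, phi}"
    using v(1) by (auto simp: f1_def f2_def f3_def character5_def mem_L_polygon split: if_splits)
  then obtain k where "\<gamma> 0 = cls 1 0 2 0 k 1 1"
    using vertex_class[of "v $ 1" "v $ 2" 1 0 2 0 j] v by (auto simp: pt_eta)
  with vertex_not_in_chart[OF U(1)] U(2) show False by metis
qed

section \<open>The orbit\<close>

lemma SL2_simps:
  "carrier SL2 = {M. det M = 1}" "M \<otimes>\<^bsub>SL2\<^esub> N = M ** N" "\<one>\<^bsub>SL2\<^esub> = mat 1"
  by (simp_all add: SL2_def)

lemma group_SL2: "group SL2"
proof (rule groupI)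
  fix M assume "M \<in> carrier SL2"
  then have M: "det M = 1" by (simp add: SL2_simps)
  then obtain N where N: "M ** N = mat 1" "N ** M = mat 1"
    using invertible_det_nz[of M] by (auto simp: invertible_def)
  then have "det N = 1" using M by (metis det_I det_mul mult_1)
  with N show "\<exists>N\<in>carrier SL2. N \<otimes>\<^bsub>SL2\<^esub> M = \<one>\<^bsub>SL2\<^esub>" by (auto simp: SL2_simps)
qed (auto simp: SL2_simps det_mul matrix_mul_assoc)

lemma SL2_inv:
  assumes "det M = 1"
  shows "M ** inv\<^bsub>SL2\<^esub> M = mat 1" "inv\<^bsub>SL2\<^esub> M ** M = mat 1"
  using group.r_inv[OF group_SL2, of M] group.l_inv[OF group_SL2, of M] assms
  by (simp_all add: SL2_simps)

text \<open>The second conjunct makes the property pass to inverses, which occur in a generated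
  group.\<close>

definition permutes_surfaces :: "'a surface set \<Rightarrow> real^2^2 \<Rightarrow> bool" where
  "permutes_surfaces S M \<longleftrightarrow> (\<forall>X\<in>S. \<exists>Y\<in>S. translation_iso (matrix_act M X) Y) \<and>
    (\<forall>Y\<in>S. \<exists>X\<in>S. translation_iso (matrix_act M X) Y)"

lemma permutes_surfaces_mult:
  assumes "permutes_surfaces S M" "permutes_surfaces S N" "det M = 1"
  shows "permutes_surfaces S (M ** N)"
proof -
  have comp: "translation_iso (matrix_act (M ** N) X) Z"
    if "translation_iso (matrix_act N X) Y" "translation_iso (matrix_act M Y) Z" for X Y Z :: "'a surface"
    unfolding matrix_act_mult
    using translation_iso_trans[OF translation_iso_matrix_act[OF that(1) SL2_inv[OF assms(3)]] that(2)] .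
  show ?thesis
    unfolding permutes_surfaces_def
  proof (intro conjI ballI)
    fix X assume "X \<in> S"
    then obtain Y Z where "Y \<in> S" "Z \<in> S" "translation_iso (matrix_act N X) Y" "translation_iso (matrix_act M Y) Z"
      using assms(1,2) unfolding permutes_surfaces_def by metis
    then show "\<exists>Z\<in>S. translation_iso (matrix_act (M ** N) X) Z" using comp by blast
  next
    fix Z assume "Z \<in> S"
    then obtain X Y where "X \<in> S" "Y \<in> S" "translation_iso (matrix_act N X) Y" "translation_iso (matrix_act M Y) Z"
      using assms(1,2) unfolding permutes_surfaces_def by metis
    then show "\<exists>X\<in>S. translation_iso (matrix_act (M ** N) X) Z" using comp by blast
  qed
qed

lemma permutes_surfaces_inv:
  assumes "permutes_surfaces S M" "det M = 1" "\<And>X. X \<in> S \<Longrightarrow> extensional_charts X"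
  shows "permutes_surfaces S (inv\<^bsub>SL2\<^esub> M)"
proof -
  let ?N = "inv\<^bsub>SL2\<^esub> M"
  note inv = SL2_inv[OF assms(2)]
  have flip: "translation_iso (matrix_act ?N Y) X"
    if "X \<in> S" "translation_iso (matrix_act M X) Y" for X Y
  proof -
    have "translation_iso X (matrix_act ?N Y)"
      using translation_iso_matrix_act[OF that(2) inv(2,1)]
      by (simp add: matrix_act_mult[symmetric] inv matrix_act_one)
    then show ?thesis by (rule translation_iso_sym) (rule assms(3)[OF that(1)])
  qed
  then show ?thesis
    using assms(1) unfolding permutes_surfaces_def by metis
qed

lemma permutes_surfaces_generate:
  assumes "M \<in> generate SL2 H" "\<And>M. M \<in> H \<Longrightarrow> det M = 1 \<and> permutes_surfaces S M"
    and "\<And>X. X \<in> S \<Longrightarrow> extensional_charts X"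
  shows "det M = 1 \<and> permutes_surfaces S M"
  using assms(1)
proof induction
  case one
  show ?case
    using translation_iso_refl by (auto simp: SL2_simps permutes_surfaces_def matrix_act_one)
next
  case (incl h)
  then show ?case by (rule assms(2))
next
  case (inv h)
  then have h: "det h = 1" "permutes_surfaces S h" using assms(2) by auto
  from group.inv_closed[OF group_SL2, of h] h(1) have "det (inv\<^bsub>SL2\<^esub> h) = 1"
    by (simp add: SL2_simps)
  with permutes_surfaces_inv[OF h(2,1) assms(3)] show ?case by simp
next
  case (eng M N)
  then show ?case by (simp add: SL2_simps det_mul permutes_surfaces_mult)
qed

lemma det_T: "det T_mat = 1" and det_R: "det R_mat = 1"
  by (simp_all add: det_2 T_mat_def R_mat_def)

theorem proposition3p25:
  fixes \<Gamma> :: "(real^2^2) set"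
  assumes "\<Gamma> = veech_group golden_L"
    and "\<Gamma> = generate SL2 {T_mat, R_mat}"
  shows "let A = L_cover 1 3 2 4; B = L_cover 1 2 2 1; C = L_cover 1 1 2 3;
             D = L_cover 1 0 2 0; E = L_cover 1 4 2 2; F = L_cover 0 1 0 3
    in surface_orbit \<Gamma> A = surface_class ` {A, B, C, D, E, F} \<and>
       card (surface_orbit \<Gamma> A) = 6 \<and>
       translation_iso (matrix_act T_mat A) B \<and>
       translation_iso (matrix_act T_mat B) C \<and>
       translation_iso (matrix_act T_mat C) D \<and>
       translation_iso (matrix_act T_mat D) E \<and>
       translation_iso (matrix_act T_mat E) A \<and>
       translation_iso (matrix_act T_mat F) F \<and>
       translation_iso (matrix_act R_mat A) B \<and>
       translation_iso (matrix_act R_mat B) A \<and>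
       translation_iso (matrix_act R_mat D) F \<and>
       translation_iso (matrix_act R_mat F) D \<and>
       translation_iso (matrix_act R_mat C) C \<and>
       translation_iso (matrix_act R_mat E) E"
proof -
  define A B C D E F where "A = L_cover 1 3 2 4" "B = L_cover 1 2 2 1" "C = L_cover 1 1 2 3"
    "D = L_cover 1 0 2 0" "E = L_cover 1 4 2 2" "F = L_cover 0 1 0 3"
  note defs = this
  let ?S = "{A, B, C, D, E, F}"
  have T: "translation_iso (matrix_act T_mat (L_cover a b c d)) (L_cover a b' c d')"
    if "b' = b - a" "d' = d - a - c" for a b c d b' d'
    unfolding L_cover_eq that by (rule T_act)
  have R: "translation_iso (matrix_act R_mat (L_cover a b c d)) (L_cover a' b' c' d')"
    if "u * w = 1" "a' = u * - d" "b' = u * c" "c' = u * - b" "d' = u * a" for a b c d u w a' b' c' d'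
    unfolding L_cover_eq that(2-) by (rule translation_iso_trans[OF R_act relabel[OF that(1)]])
  have T_iso: "translation_iso (matrix_act T_mat A) B" "translation_iso (matrix_act T_mat B) C"
    "translation_iso (matrix_act T_mat C) D" "translation_iso (matrix_act T_mat D) E"
    "translation_iso (matrix_act T_mat E) A" "translation_iso (matrix_act T_mat F) F"
    unfolding defs by (rule T; simp)+
  have R_iso: "translation_iso (matrix_act R_mat A) B" "translation_iso (matrix_act R_mat B) A"
    "translation_iso (matrix_act R_mat D) F" "translation_iso (matrix_act R_mat F) D"
    "translation_iso (matrix_act R_mat C) C" "translation_iso (matrix_act R_mat E) E"
  proof -
    \<comment> \<open>In each case the unit rescales the first nonzero entry of the turned tuple
      \<open>(- d, c, - b, a)\<close> to 1. For instance, D turns into (0, 2, 0, 1), and the factor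
      3 gives (0, 1, 0, 3).\<close>
    show "translation_iso (matrix_act R_mat A) B" unfolding defs by (rule R[of 1 1]; simp)
    show "translation_iso (matrix_act R_mat B) A" unfolding defs by (rule R[of 4 4]; simp)
    show "translation_iso (matrix_act R_mat D) F" unfolding defs by (rule R[of 3 2]; simp)
    show "translation_iso (matrix_act R_mat F) D" unfolding defs by (rule R[of 3 2]; simp)
    show "translation_iso (matrix_act R_mat C) C" unfolding defs by (rule R[of 3 2]; simp)
    show "translation_iso (matrix_act R_mat E) E" unfolding defs by (rule R[of 2 3]; simp)
  qed
  have ext: "extensional_charts X" if "X \<in> ?S" for X
    using that by (auto simp: defs L_cover_eq extensional_charts_glued)
  have perm: "permutes_surfaces ?S T_mat" "permutes_surfaces ?S R_mat"
    unfolding permutes_surfaces_def using T_iso R_iso by blast+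
  have \<Gamma>: "det M = 1 \<and> permutes_surfaces ?S M" if "M \<in> \<Gamma>" for M
    using that unfolding assms(2)
    by (rule permutes_surfaces_generate) (use perm ext det_T det_R in auto)
  have class_eq: "surface_class X = surface_class Y \<longleftrightarrow> translation_iso X Y"
    if "extensional_charts X" for X Y :: "(5 \<times> plane) set surface"
    using that by (rule surface_class_eq_iff)
  have ext_act: "extensional_charts (matrix_act M X)" if "det M = 1" "X \<in> ?S" for M X
    using extensional_charts_matrix_act[OF ext[OF that(2)] SL2_inv[OF that(1)]] .
  have reach: "surface_class Y \<in> surface_orbit \<Gamma> A"
    if X: "surface_class X \<in> surface_orbit \<Gamma> A" and Y: "translation_iso (matrix_act M X) Y" and M: "M \<in> \<Gamma>"
    for M X Y
  proof -
    obtain N where N: "N \<in> \<Gamma>" "surface_class X = surface_class (matrix_act N A)"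
      using X by (auto simp: surface_orbit_def)
    have det: "det M = 1" "det N = 1" using \<Gamma> N(1) M by auto
    have NA: "translation_iso (matrix_act N A) X"
      using N(2) class_eq[OF ext_act[OF det(2)], of A X] by simp
    have "translation_iso (matrix_act (M ** N) A) Y"
      unfolding matrix_act_mult
      using translation_iso_trans[OF translation_iso_matrix_act[OF NA SL2_inv[OF det(1)]] Y] .
    moreover have "M ** N \<in> \<Gamma>"
      using generate.eng[of M SL2 _ N] N(1) M unfolding assms(2) by (simp add: SL2_simps)
    moreover from this have "extensional_charts (matrix_act (M ** N) A)"
      using \<Gamma> by (intro ext_act) auto
    ultimately show ?thesis
      using class_eq unfolding surface_orbit_def by (metis imageI)
  qed
  have gen: "T_mat \<in> \<Gamma>" "R_mat \<in> \<Gamma>" "mat 1 \<in> \<Gamma>"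
    unfolding assms(2) using generate.one[of SL2] by (auto simp: SL2_simps intro: generate.incl)
  have orbit: "surface_orbit \<Gamma> A = surface_class ` ?S"
  proof
    show "surface_orbit \<Gamma> A \<subseteq> surface_class ` ?S"
    proof
      fix c assume "c \<in> surface_orbit \<Gamma> A"
      then obtain M where M: "M \<in> \<Gamma>" "c = surface_class (matrix_act M A)"
        by (auto simp: surface_orbit_def)
      then obtain Y where "Y \<in> ?S" "translation_iso (matrix_act M A) Y"
        using \<Gamma>[OF M(1)] unfolding permutes_surfaces_def by blast
      moreover from this have "c = surface_class Y"
        using class_eq[OF ext_act[of M A]] \<Gamma>[OF M(1)] M(2) by simp
      ultimately show "c \<in> surface_class ` ?S" by blast
    qed
    have "surface_class A \<in> surface_orbit \<Gamma> A"
      unfolding surface_orbit_def using gen(3) by (intro image_eqI[of _ _ "mat 1"]) (simp_all add: matrix_act_one)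
    note a = this
    note b = reach[OF a T_iso(1) gen(1)]
    note c = reach[OF b T_iso(2) gen(1)]
    note d = reach[OF c T_iso(3) gen(1)]
    note e = reach[OF d T_iso(4) gen(1)]
    note f = reach[OF d R_iso(3) gen(2)]
    show "surface_class ` ?S \<subseteq> surface_orbit \<Gamma> A"
      using a b c d e f by simp
  qed
  have "\<not> translation_iso D F"
  proof
    assume "translation_iso D F"
    then have "closed_horizontal phi D"
      by (rule closed_horizontal_iso)
        (auto simp: defs L_cover_eq closed_horizontal_L_glued charts_glued dest: openin_subset)
    then show False
      using no_closed_horizontal by (simp add: defs L_cover_eq)
  qed
  then have DF: "surface_class D \<noteq> surface_class F"
    using class_eq ext by simp
  txt \<open>
    The action of \<open>T\<close> and \<open>R\<close> descends to classes, where every coincidence among the six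
    classes would propagate to \<open>D\<close> and \<open>F\<close>.
  \<close>
  define act where "act M c = (\<Union>X\<in>c \<inter> ?S. surface_class (matrix_act M X))" for M c
  have act: "act M (surface_class X) = surface_class Y"
    if det: "det M = 1" and X: "X \<in> ?S" and Y: "translation_iso (matrix_act M X) Y" for M X Y
  proof -
    \<comment> \<open>All representatives contribute the same set to the union, so
      \<open>act\<close> is well defined. Those in \<open>?S\<close> have extensional charts, as the
      comparison of classes requires.\<close>
    have "surface_class (matrix_act M Z) = surface_class Y" if Z: "Z \<in> surface_class X \<inter> ?S" for Z
    proof -
      have "translation_iso Z X"
        using Z translation_iso_sym[OF _ ext[OF X]] by (auto simp: surface_class_def)
      from translation_iso_matrix_act[OF this SL2_inv[OF det]]
      have "translation_iso (matrix_act M Z) Y"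
        using Y translation_iso_trans by blast
      then show ?thesis using class_eq ext_act[OF det] Z by blast
    qed
    moreover have "X \<in> surface_class X \<inter> ?S"
      using X translation_iso_refl by (simp add: surface_class_def)
    ultimately show ?thesis unfolding act_def by blast
  qed
  obtain t r where t: "t (surface_class A) = surface_class B" "t (surface_class B) = surface_class C"
      "t (surface_class C) = surface_class D" "t (surface_class D) = surface_class E"
      "t (surface_class E) = surface_class A" "t (surface_class F) = surface_class F"
    and r: "r (surface_class A) = surface_class B" "r (surface_class D) = surface_class F"
    using act[OF det_T] T_iso act[OF det_R] R_iso by (metis insertCI)
  \<comment> \<open>As 5 is prime, an equality inside the 5-cycle of \<open>t\<close> spreads to all
    five classes; then A = D, and \<open>r\<close> gives B = F, so D = F. An equality of one of the
    five with the fixed class F is carried by \<open>t\<close> to D = F.\<close>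
  have "distinct [surface_class A, surface_class B, surface_class C, surface_class D,
      surface_class E, surface_class F]"
    using DF t r by (simp, metis)
  then have "card (surface_orbit \<Gamma> A) = 6"
    unfolding orbit by simp
  with orbit T_iso R_iso show ?thesis
    unfolding Let_def defs[symmetric] by blast
qed

end
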